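(* Let $n\in\mathbb{N}\setminus\{0,1\}$ and let $t_1,t_2,T$ be real numbers with $0<t_1<t_2<T$. Let $u\in L^2((0,T)\times(-n,n))$ satisfy $Pu=0$ in $(0,T)\times(-n,n)$ and $\operatorname{supp} u\subset[t_1,t_2]\times(-n,n)$. Let $0<\epsilon<\min(t_1,T-t_2)$. Then there exists $v\in L^2((0,T)\times(-n-1,n+1))$ such that $Pv=0$ in $(0,T)\times(-n-1,n+1)$, $\operatorname{supp} v\subset[t_1-\epsilon,t_2+\epsilon]\times(-n-1,n+1)$, and $$\|v-u\|_{L^2((0,T)\times(-n+1,n-1))}<\epsilon.$$
   Context: $P=\partial_t+\partial_x+\partial_x^3-\partial_x^5$ is the linear Kawahara operator; equations $Pu=0$ on an open set are understood in the sense of distributions on that set. *)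

theory Defs
  imports "HOL-Analysis.Analysis"
begin

definition strip :: "real \<Rightarrow> real \<Rightarrow> (real \<times> real) set" where
  "strip T a = {p. 0 < fst p \<and> fst p < T \<and> - a < snd p \<and> snd p < a}"

text \<open>D i j is the mixed partial derivative d_t^i d_x^j of D 0 0; all exist
  everywhere and are continuous, i.e. D 0 0 is C-infinity.\<close>
definition smooth_family :: "(nat \<Rightarrow> nat \<Rightarrow> real \<times> real \<Rightarrow> real) \<Rightarrow> bool" where
  "smooth_family D \<longleftrightarrow>
     (\<forall>i j. continuous_on UNIV (D i j) \<and>
        (\<forall>t x. ((\<lambda>s. D i j (s, x)) has_real_derivative D (Suc i) j (t, x)) (at t) \<and>
               ((\<lambda>y. D i j (t, y)) has_real_derivative D i (Suc j) (t, x)) (at x)))"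

definition test_fun :: "(real \<times> real) set \<Rightarrow> (nat \<Rightarrow> nat \<Rightarrow> real \<times> real \<Rightarrow> real) \<Rightarrow> bool" where
  "test_fun \<Omega> D \<longleftrightarrow> smooth_family D \<and>
     compact (closure {p. D 0 0 p \<noteq> 0}) \<and> closure {p. D 0 0 p \<noteq> 0} \<subseteq> \<Omega>"

definition L2_on :: "(real \<times> real) set \<Rightarrow> (real \<times> real \<Rightarrow> real) \<Rightarrow> bool" where
  "L2_on \<Omega> u \<longleftrightarrow> u \<in> borel_measurable (lebesgue_on \<Omega>) \<and>
     set_integrable lebesgue \<Omega> (\<lambda>p. (u p)\<^sup>2)"

definition L2_norm_on :: "(real \<times> real) set \<Rightarrow> (real \<times> real \<Rightarrow> real) \<Rightarrow> real" where
  "L2_norm_on \<Omega> u = sqrt (set_lebesgue_integral lebesgue \<Omega> (\<lambda>p. (u p)\<^sup>2))"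

text \<open>P u = 0 in the sense of distributions on Omega, where
  P = d_t + d_x + d_x^3 - d_x^5; the formal adjoint is
  -d_t - d_x - d_x^3 + d_x^5.\<close>
definition kawahara_sol :: "(real \<times> real) set \<Rightarrow> (real \<times> real \<Rightarrow> real) \<Rightarrow> bool" where
  "kawahara_sol \<Omega> u \<longleftrightarrow>
     (\<forall>D. test_fun \<Omega> D \<longrightarrow>
        set_lebesgue_integral lebesgue \<Omega>
          (\<lambda>p. u p * (- D 1 0 p - D 0 1 p - D 0 3 p + D 0 5 p)) = 0)"

definition supp_in :: "(real \<times> real) set \<Rightarrow> (real \<times> real \<Rightarrow> real) \<Rightarrow> (real \<times> real) set \<Rightarrow> bool" where
  "supp_in \<Omega> u S \<longleftrightarrow> (AE p in lebesgue_on \<Omega>. p \<notin> S \<longrightarrow> u p = 0)"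

end

theory Submission
  imports Defs "HOL-Complex_Analysis.Cauchy_Integral_Formula"
begin

text \<open>
  Mollify \<open>u\<close> in both variables with a compactly supported bump that is Gevrey of order 2.  The result
  \<open>w\<close> is a classical solution on a slightly narrower strip, its time support grows only by the width of
  the bump, and \<open>\<partial>\<^sub>t\<^sup>k w\<close> is bounded by \<open>C R\<^sup>k (k!)\<^sup>2\<close>.  Reading the equation as
  \<open>\<partial>\<^sub>x\<^sup>5 w = \<partial>\<^sub>t w + \<partial>\<^sub>x w + \<partial>\<^sub>x\<^sup>3 w\<close>, five \<open>x\<close>-derivatives cost one \<open>t\<close>-derivative, so
  \<open>\<partial>\<^sub>x\<^sup>j w\<close> is bounded by \<open>C A\<^sup>j ((j div 5)!)\<^sup>2\<close>.  Hence \<open>w\<close> is entire in \<open>x\<close>, and its Taylor series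
  at \<open>x = 0\<close> extends it to a classical solution \<open>v\<close> on all of the plane with the same time support.
  As the width of the bump tends to 0, \<open>w\<close> tends to \<open>u\<close> in \<open>L\<^sup>2\<close>.
\<close>

section \<open>A Gevrey bump function\<close>

text \<open>A nonzero function with compact time support cannot be analytic in t, while continuation
  in x from a line x = const is an ill-posed Cauchy problem that demands strong regularity in t. The
  order five of the equation leaves room between the two: if i time derivatives cost (i!)^2, the
  j-th Taylor coefficient in x has size about ((j/5)!)^2 / j!, which still decays
  superexponentially; any Gevrey order below 5 would leave such decay. Order 2 is what Cauchy's
  estimate yields for exp(-2/(1-t^2)): one factorial from Cauchy's formula on a circle whose radius
  is proportional to the distance to the poles, a second one from absorbing the powers of that
  radius into the exponential. Mollifying with width d < 1 costs d in each direction. In space this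
  confines the use of the equation for w to |x| <= n - 1, which is why closeness is measured on the
  narrower strip. The extension reads off only the line x = 0; that it agrees with w for |x| <= n -
  1 is a separate fact, and there the derivative bounds on the whole narrower strip enter.\<close>

definition cbump :: "complex \<Rightarrow> complex" where
  "cbump z = exp (- inverse (1 - z) - inverse (1 + z))"

text \<open>The k-th derivative of exp(-2/(1-t^2)), extended by zero. All orders are defined at once
  through complex derivatives of the holomorphic \<open>cbump\<close>, so that Cauchy estimates
  apply for |t| < 1 and only the fit at |t| = 1 remains to be shown.\<close>

definition bump :: "nat \<Rightarrow> real \<Rightarrow> real" where
  "bump k t = (if \<bar>t\<bar> < 1 then Re ((deriv ^^ k) cbump (of_real t)) else 0)"

lemma open_cbump_domain: "open (- {1, -1::complex})"
  by (intro open_Compl finite_imp_closed) auto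

lemma holomorphic_cbump: "cbump holomorphic_on (- {1, -1})"
proof -
  have "1 - z \<noteq> 0 \<and> 1 + z \<noteq> 0" if "z \<in> - {1, -1}" for z :: complex
    using that by (auto simp: add_eq_0_iff minus_equation_iff)
  then show ?thesis
    unfolding cbump_def by (intro holomorphic_intros) auto
qed

text \<open>Re(1/z) = Re z / |z|^2, and on this disc Re z >= d/2 while |z| <= 3d/2; the constant is
  (d/2) / (3d/2)^2.\<close>

lemma Re_inverse_ge:
  assumes d: "0 < d" and z: "cmod (z - of_real d) \<le> d / 2"
  shows "2 / (9 * d) \<le> Re (inverse z)"
proof -
  have "\<bar>Re (z - of_real d)\<bar> \<le> d / 2"
    using abs_Re_le_cmod z by (rule order_trans)
  then have re: "d / 2 \<le> Re z"
    by (simp add: abs_if split: if_splits)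
  have "cmod z \<le> cmod (of_real d) + cmod (z - of_real d)"
    by (metis add.commute diff_add_cancel norm_triangle_ineq)
  then have "cmod z \<le> 3 * d / 2"
    using d z by simp
  then have n: "(cmod z)\<^sup>2 \<le> (3 * d / 2)\<^sup>2"
    by (intro power_mono) auto
  have p: "0 < (cmod z)\<^sup>2"
    using re d by auto
  have "2 / (9 * d) = (d / 2) / (3 * d / 2)\<^sup>2"
    using d by (simp add: field_simps power2_eq_square)
  also have "\<dots> \<le> Re z / (cmod z)\<^sup>2"
    using re n d p by (intro frac_le) auto
  finally show ?thesis
    by (simp add: cmod_power2)
qed

lemma cbump_bound:
  assumes t: "\<bar>t\<bar> < 1" and z: "cmod (z - of_real t) \<le> (1 - \<bar>t\<bar>) / 2"
  shows "cmod (cbump z) \<le> exp (- (2 / (9 * (1 - \<bar>t\<bar>))))"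
proof -
  have a: "2 / (9 * (1 - \<bar>t\<bar>)) \<le> Re (inverse (1 - z)) + Re (inverse (1 + z))"
  proof (cases "0 \<le> t")
    case True
    have "2 / (9 * (1 - t)) \<le> Re (inverse (1 - z))"
      using t z True by (intro Re_inverse_ge) (auto simp: norm_minus_commute)
    moreover have "2 / (9 * (1 + t)) \<le> Re (inverse (1 + z))"
      using t z True by (intro Re_inverse_ge) auto
    moreover have "0 \<le> 2 / (9 * (1 + t))"
      using True by simp
    ultimately show ?thesis
      using True by (metis abs_of_nonneg add_increasing2 order_trans)
  next
    case False
    have "2 / (9 * (1 - t)) \<le> Re (inverse (1 - z))"
      using t z False by (intro Re_inverse_ge) (auto simp: norm_minus_commute)
    moreover have "2 / (9 * (1 + t)) \<le> Re (inverse (1 + z))"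
      using t z False by (intro Re_inverse_ge) auto
    moreover have "0 \<le> 2 / (9 * (1 - t))"
      using False by simp
    ultimately show ?thesis
      using False
      by (metis abs_of_neg add_increasing diff_minus_eq_add linorder_not_le order_trans)
  qed
  then show ?thesis
    unfolding cbump_def norm_exp_eq_Re by simp
qed

text \<open>A single term of the exponential series bounds exp y from below; leaving
  \<open>m\<close> free lets exponential decay be traded for any power of 1/y.\<close>

lemma exp_minus_le_fact:
  assumes "0 < (y::real)"
  shows "exp (- y) \<le> fact m / y ^ m"
proof -
  have "y ^ m /\<^sub>R fact m \<le> (\<Sum>k\<le>m. y ^ k /\<^sub>R fact k)"
    using assms by (intro member_le_sum) auto
  also have "\<dots> \<le> exp y"
    using assms summable_exp_generic[of y] unfolding exp_def
    by (intro sum_le_suminf) auto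
  finally have "y ^ m / fact m \<le> exp y"
    by (simp add: field_simps)
  then show ?thesis
    using assms by (simp add: exp_minus field_simps)
qed

text \<open>The parameter \<open>m\<close> buys vanishing at the endpoints: \<open>m\<close> = 0
  gives the Gevrey bound, \<open>m\<close> = 2 the flatness needed to differentiate across |t| =
  1.\<close>

lemma bump_bound_inside:
  assumes t: "\<bar>t\<bar> < 1"
  shows "\<bar>bump k t\<bar> \<le> fact k * fact (k + m) * 9 ^ (k + m) * (1 - \<bar>t\<bar>) ^ m"
proof -
  define d where "d = 1 - \<bar>t\<bar>"
  have d: "0 < d" using t by (simp add: d_def)
  have sub: "cball (of_real t) (d / 2) \<subseteq> - {1, -1::complex}"
  proof -
    have "cmod (of_real t - 1) = \<bar>t - 1\<bar>" "cmod (of_real t + 1) = \<bar>t + 1\<bar>"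
      by (metis norm_of_real of_real_1 of_real_diff of_real_add)+
    then show ?thesis
      using t by (auto simp: dist_norm d_def)
  qed
  have "cmod ((deriv ^^ k) cbump (of_real t)) \<le> fact k * exp (- (2 / (9 * d))) / (d / 2) ^ k"
  proof (rule Cauchy_inequality)
    show "cbump holomorphic_on ball (of_real t) (d / 2)"
      by (rule holomorphic_on_subset[OF holomorphic_cbump]) (use sub ball_subset_cball in blast)
    show "continuous_on (cball (of_real t) (d / 2)) cbump"
      by (rule holomorphic_on_imp_continuous_on, rule holomorphic_on_subset[OF holomorphic_cbump sub])
    show "cmod (cbump x) \<le> exp (- (2 / (9 * d)))" if "cmod (of_real t - x) = d / 2" for x
      using cbump_bound[OF t, of x] that by (simp add: d_def norm_minus_commute)
  qed (use d in auto)
  \<comment> \<open>The series term of index \<open>k + m\<close> is chosen so that \<open>k\<close>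
    powers of \<open>d\<close> cancel the Cauchy factor (d/2)^(-k) and \<open>m\<close> powers
    survive. It is the source of the second factorial.\<close>
  also have "\<dots> \<le> fact k * (fact (k + m) / (2 / (9 * d)) ^ (k + m)) / (d / 2) ^ k"
    using d by (intro divide_right_mono mult_left_mono exp_minus_le_fact) auto
  also have "\<dots> = fact k * fact (k + m) * 9 ^ (k + m) * d ^ m / 2 ^ m"
    using d by (simp add: field_simps power_add)
  also have "\<dots> \<le> fact k * fact (k + m) * 9 ^ (k + m) * d ^ m / 1"
    using d by (intro divide_left_mono) auto
  finally have "cmod ((deriv ^^ k) cbump (of_real t)) \<le> fact k * fact (k + m) * 9 ^ (k + m) * d ^ m"
    by simp
  then show ?thesis
    using t abs_Re_le_cmod[of "(deriv ^^ k) cbump (of_real t)"] unfolding bump_def d_def by simp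
qed

lemma bump_bound: "\<bar>bump k t\<bar> \<le> 9 ^ k * (fact k)\<^sup>2"
proof (cases "\<bar>t\<bar> < 1")
  case True
  then show ?thesis
    using bump_bound_inside[of t k 0] by (simp add: power2_eq_square mult.commute)
next
  case False
  then show ?thesis by (simp add: bump_def)
qed

lemma bump_eq_0: "1 \<le> \<bar>t\<bar> \<Longrightarrow> bump k t = 0"
  by (simp add: bump_def)

text \<open>Serves twice: for the bump at its endpoints, and for the remainder when differentiating
  under an integral.\<close>

lemma has_real_derivative_0I:
  fixes f :: "real \<Rightarrow> real"
  assumes "f a = 0" and "\<And>x. \<bar>f x\<bar> \<le> C * (x - a)\<^sup>2"
  shows "(f has_real_derivative 0) (at a)"
proof -
  have "((\<lambda>x. (f x - f a) / (x - a)) \<longlongrightarrow> 0) (at a)"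
  proof (rule Lim_null_comparison)
    show "\<forall>\<^sub>F x in at a. norm ((f x - f a) / (x - a)) \<le> C * \<bar>x - a\<bar>"
      unfolding eventually_at_filter
    proof (intro always_eventually allI impI)
      fix x assume "x \<noteq> a"
      then show "norm ((f x - f a) / (x - a)) \<le> C * \<bar>x - a\<bar>"
        using assms(2)[of x] \<open>f a = 0\<close>
        by (simp add: divide_simps) (simp add: power2_eq_square abs_mult_self_eq mult.assoc)
    qed
    have "((\<lambda>x. C * \<bar>x - a\<bar>) \<longlongrightarrow> C * \<bar>a - a\<bar>) (at a)"
      by (intro tendsto_intros)
    then show "((\<lambda>x. C * \<bar>x - a\<bar>) \<longlongrightarrow> 0) (at a)"
      by simp
  qed
  then show ?thesis
    by (simp add: has_field_derivative_iff)
qed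

lemma bump_deriv: "(bump k has_real_derivative bump (Suc k) t) (at t)"
proof -
  consider "\<bar>t\<bar> < 1" | "\<bar>t\<bar> = 1" | "1 < \<bar>t\<bar>"
    by linarith
  then show ?thesis
  proof cases
    case 1
    have "of_real t \<in> - {1, -1::complex}"
      using 1 by (auto simp: complex_eq_iff)
    then have "((deriv ^^ k) cbump has_field_derivative (deriv ^^ Suc k) cbump (of_real t)) (at (of_real t))"
      by (intro has_field_derivative_higher_deriv[OF holomorphic_cbump open_cbump_domain])
    then have "((\<lambda>x. Re ((deriv ^^ k) cbump (of_real x))) has_real_derivative
        Re ((deriv ^^ Suc k) cbump (of_real t))) (at t)"
      by (intro has_field_derivative_Re has_vector_derivative_real_field)
    then have "((\<lambda>x. Re ((deriv ^^ k) cbump (of_real x))) has_real_derivative bump (Suc k) t) (at t)"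
      using 1 by (simp add: bump_def)
    then show ?thesis
    proof (rule has_field_derivative_transform_within_open[where S="{-1<..<1}"])
    qed (use 1 in \<open>auto simp: bump_def abs_if split: if_splits\<close>)
  next
    case 2
    define C where "C = fact k * fact (k + 2) * (9::real) ^ (k + 2)"
    have C: "0 \<le> C" by (simp add: C_def)
    have "(bump k has_real_derivative 0) (at t)"
    proof (rule has_real_derivative_0I)
      show "bump k t = 0" using 2 by (simp add: bump_def)
      show "\<bar>bump k x\<bar> \<le> C * (x - t)\<^sup>2" for x
      proof (cases "\<bar>x\<bar> < 1")
        case True
        have "\<bar>bump k x\<bar> \<le> C * (1 - \<bar>x\<bar>)\<^sup>2"
          using bump_bound_inside[OF True, of k 2] by (simp add: C_def)
        \<comment> \<open>Since |t| = 1, the reverse triangle inequality gives 1 - |x| <= |x -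
          t|.\<close>
        also have "\<dots> \<le> C * \<bar>x - t\<bar>\<^sup>2"
          using True 2 C by (intro mult_left_mono power_mono) auto
        finally show ?thesis by simp
      next
        case False
        then show ?thesis using C by (simp add: bump_def)
      qed
    qed
    then show ?thesis
      using 2 by (simp add: bump_def)
  next
    case 3
    have "((\<lambda>x. 0) has_real_derivative bump (Suc k) t) (at t)"
      using 3 by (simp add: bump_def)
    moreover have "open {x::real. 1 < \<bar>x\<bar>}"
      by (intro open_Collect_less continuous_intros)
    ultimately show ?thesis
      by (rule has_field_derivative_transform_within_open) (use 3 in \<open>auto simp: bump_def\<close>)
  qed
qed

lemma continuous_on_bump: "continuous_on A (bump k)"
  by (rule DERIV_continuous_on[OF has_field_derivative_at_within[OF bump_deriv]])

lemma bump_0_pos: "\<bar>t\<bar> < 1 \<Longrightarrow> 0 < bump 0 t"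
proof -
  assume t: "\<bar>t\<bar> < 1"
  have "cbump (of_real t) = of_real (exp (- inverse (1 - t) - inverse (1 + t)))"
    by (simp add: cbump_def flip: exp_of_real)
  then show ?thesis
    using t by (simp add: bump_def)
qed

lemma bump_0_nonneg: "0 \<le> bump 0 t"
proof (cases "\<bar>t\<bar> < 1")
  case True
  then show ?thesis using bump_0_pos by (simp add: less_imp_le)
next
  case False
  then show ?thesis by (simp add: bump_eq_0)
qed

lemma borel_measurable_bump [measurable]: "bump k \<in> borel_measurable borel"
  by (intro borel_measurable_continuous_onI continuous_on_bump)

lemma integrable_bump: "integrable lborel (bump k)"
proof -
  have "integrable lborel (\<lambda>t. indicator {-1..1} t *\<^sub>R bump k t)"
    by (intro borel_integrable_compact continuous_on_bump) auto
  moreover have "(\<lambda>t. indicator {-1..1} t *\<^sub>R bump k t) = bump k"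
  proof
    show "indicator {-1..1} t *\<^sub>R bump k t = bump k t" for t
      using bump_eq_0[of t k] by (cases "1 \<le> \<bar>t\<bar>") (auto simp: indicator_def)
  qed
  ultimately show ?thesis
    by metis
qed

lemma bump_integral_pos: "0 < (\<integral>t. bump 0 t \<partial>lborel)"
proof -
  have "(\<integral>t. bump 0 t \<partial>lborel) \<noteq> 0"
  proof
    assume "(\<integral>t. bump 0 t \<partial>lborel) = 0"
    then have "AE t in lborel. bump 0 t = 0"
      by (subst (asm) integral_nonneg_eq_0_iff_AE[OF integrable_bump]) (auto simp: bump_0_nonneg)
    then have "AE t in lborel. t \<notin> {-1<..<1::real}"
      by eventually_elim (use bump_0_pos in \<open>force simp: abs_less_iff\<close>)
    then have "emeasure lborel {-1<..<1::real} = 0"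
      by (subst (asm) AE_iff_measurable[where N="{-1<..<1}"]) auto
    then show False by simp
  qed
  moreover have "0 \<le> (\<integral>t. bump 0 t \<partial>lborel)"
    by (intro integral_nonneg_AE) (auto simp: bump_0_nonneg)
  ultimately show ?thesis by linarith
qed

section \<open>Mollification\<close>

text \<open>The k-th derivative of the kernel of mass 1 supported in [-d, d]: in
  \<open>d ^ Suc k\<close> one power normalises the mass and \<open>k\<close> come from the chain
  rule.\<close>

definition moll :: "real \<Rightarrow> nat \<Rightarrow> real \<Rightarrow> real" where
  "moll d k t = bump k (t / d) / ((\<integral>s. bump 0 s \<partial>lborel) * d ^ Suc k)"

lemma moll_deriv:
  assumes "0 < d"
  shows "(moll d k has_real_derivative moll d (Suc k) t) (at t)"
proof -
  have "((\<lambda>t. bump k (t / d)) has_real_derivative bump (Suc k) (t / d) * (1 / d)) (at t)"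
    by (rule DERIV_chain2[OF bump_deriv]) (use assms in \<open>auto intro!: derivative_eq_intros\<close>)
  then have "((\<lambda>t. bump k (t / d) / ((\<integral>s. bump 0 s \<partial>lborel) * d ^ Suc k)) has_real_derivative
     bump (Suc k) (t / d) * (1 / d) / ((\<integral>s. bump 0 s \<partial>lborel) * d ^ Suc k)) (at t)"
    by (rule DERIV_cdivide)
  then show ?thesis
    by (simp add: moll_def[abs_def] mult.assoc mult.left_commute)
qed

lemma moll_eq_0: "0 < d \<Longrightarrow> d \<le> \<bar>t\<bar> \<Longrightarrow> moll d k t = 0"
  by (simp add: moll_def bump_eq_0 abs_divide)

lemma moll_nonneg: "0 < d \<Longrightarrow> 0 \<le> moll d 0 t"
  using bump_integral_pos by (simp add: moll_def bump_0_nonneg)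

lemma moll_bound:
  assumes "0 < d"
  obtains C where "0 < C" "\<And>k t. \<bar>moll d k t\<bar> \<le> C * (9 / d) ^ k * (fact k)\<^sup>2"
proof
  let ?I = "\<integral>s. bump 0 s \<partial>lborel"
  have I: "0 < ?I" by (rule bump_integral_pos)
  show "0 < 1 / (?I * d)" using I assms by simp
  show "\<bar>moll d k t\<bar> \<le> 1 / (?I * d) * (9 / d) ^ k * (fact k)\<^sup>2" for k t
  proof -
    have "\<bar>moll d k t\<bar> = \<bar>bump k (t / d)\<bar> / (?I * d ^ Suc k)"
      using I assms by (simp add: moll_def abs_mult)
    also have "\<dots> \<le> (9 ^ k * (fact k)\<^sup>2) / (?I * d ^ Suc k)"
      using I assms by (intro divide_right_mono bump_bound) auto
    also have "\<dots> = 1 / (?I * d) * (9 / d) ^ k * (fact k)\<^sup>2"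
      by (simp add: power_divide)
    finally show ?thesis .
  qed
qed

lemma continuous_on_moll [continuous_intros]:
  assumes "0 < d" "continuous_on A f"
  shows "continuous_on A (\<lambda>x. moll d k (f x))"
  by (rule continuous_on_compose2[OF _ assms(2) subset_UNIV])
     (rule DERIV_continuous_on[OF has_field_derivative_at_within[OF moll_deriv[OF assms(1)]]])

lemma borel_measurable_moll [measurable]: "moll d k \<in> borel_measurable borel"
  unfolding moll_def[abs_def] by measurable

lemma borel_measurable_moll_prod [measurable]:
  "(\<lambda>p::real \<times> real. moll d i (t - fst p) * moll d j (x - snd p)) \<in> borel_measurable borel"
  unfolding borel_prod[symmetric] by measurable

lemma nn_integral_moll:
  assumes d: "0 < d"
  shows "(\<integral>\<^sup>+t. ennreal (moll d 0 (t - a)) \<partial>lborel) = 1"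
    and "(\<integral>\<^sup>+t. ennreal (moll d 0 (a - t)) \<partial>lborel) = 1"
proof -
  let ?I = "\<integral>s. bump 0 s \<partial>lborel"
  have I: "0 < ?I" by (rule bump_integral_pos)
  have b: "(\<integral>\<^sup>+t. ennreal (bump 0 t) \<partial>lborel) = ennreal ?I"
    by (intro nn_integral_eq_integral integrable_bump) (auto simp: bump_0_nonneg)
  have "(\<integral>\<^sup>+t. ennreal (bump 0 t / ?I) \<partial>lborel) = ennreal (1 / ?I) * (\<integral>\<^sup>+t. ennreal (bump 0 t) \<partial>lborel)"
    using I by (subst nn_integral_cmult[symmetric]) (auto simp: ennreal_mult'[symmetric])
  then have b': "(\<integral>\<^sup>+t. ennreal (bump 0 t / ?I) \<partial>lborel) = 1"
    using I by (simp add: b ennreal_mult'[symmetric])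
  \<comment> \<open>Translation and reflection are treated together with c = 1 or c = -1; as c * c =
    1, the substitution t = -e c + d c s turns the argument into d s.\<close>
  have gen: "(\<integral>\<^sup>+t. ennreal (moll d 0 (e + c * t)) \<partial>lborel) = 1" if c: "\<bar>c\<bar> = 1" for c e
  proof -
    have "(\<integral>\<^sup>+t. ennreal (moll d 0 (e + c * t)) \<partial>lborel)
        = d * (\<integral>\<^sup>+t. ennreal (moll d 0 (e + c * (- e * c + d * c * t))) \<partial>lborel)"
      by (subst nn_integral_real_affine[where c="d * c" and t="- e * c"]) (use d c in \<open>auto simp: abs_mult\<close>)
    also have "(\<lambda>t. e + c * (- e * c + d * c * t)) = (\<lambda>t. d * t)"
      using c by (cases "c < 0") (simp_all add: fun_eq_iff algebra_simps)
    also have "ennreal d * (\<integral>\<^sup>+t. ennreal (moll d 0 (d * t)) \<partial>lborel) = (\<integral>\<^sup>+t. ennreal (bump 0 t / ?I) \<partial>lborel)"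
      using d by (subst nn_integral_cmult[symmetric]) (auto simp: moll_def ennreal_mult'[symmetric])
    finally show ?thesis
      by (simp add: b')
  qed
  show "(\<integral>\<^sup>+t. ennreal (moll d 0 (t - a)) \<partial>lborel) = 1"
    using gen[of 1 "-a"] by simp
  show "(\<integral>\<^sup>+t. ennreal (moll d 0 (a - t)) \<partial>lborel) = 1"
    using gen[of "-1" "a"] by simp
qed

text \<open>All derivatives sit on the kernel from the outset, so \<open>f\<close> only needs to be
  integrable; that the indices really count t- and x-derivatives is proved afterwards.\<close>

definition mollify :: "real \<Rightarrow> (real \<times> real \<Rightarrow> real) \<Rightarrow> nat \<Rightarrow> nat \<Rightarrow> real \<Rightarrow> real \<Rightarrow> real" where
  "mollify d f i j t x = (\<integral>p. f p * (moll d i (t - fst p) * moll d j (x - snd p)) \<partial>lborel)"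

lemma moll_prod_bound:
  assumes d: "0 < d"
  obtains C where "0 < C"
    "\<And>i j a b. \<bar>moll d i a * moll d j b\<bar> \<le> C * ((9 / d) ^ i * (fact i)\<^sup>2) * ((9 / d) ^ j * (fact j)\<^sup>2)"
proof -
  obtain C where C: "0 < C" "\<And>k t. \<bar>moll d k t\<bar> \<le> C * (9 / d) ^ k * (fact k)\<^sup>2"
    using moll_bound[OF d] by blast
  have "\<bar>moll d i a * moll d j b\<bar> \<le> (C * C) * ((9 / d) ^ i * (fact i)\<^sup>2) * ((9 / d) ^ j * (fact j)\<^sup>2)" for i j a b
  proof -
    have "\<bar>moll d i a * moll d j b\<bar> \<le> (C * (9 / d) ^ i * (fact i)\<^sup>2) * (C * (9 / d) ^ j * (fact j)\<^sup>2)"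
      unfolding abs_mult using C d by (intro mult_mono) auto
    then show ?thesis by (simp only: mult_ac)
  qed
  moreover have "0 < C * C" using C(1) by simp
  ultimately show thesis using that by blast
qed

lemma integrable_mollify:
  assumes d: "0 < d" and f: "integrable lborel f"
  shows "integrable lborel (\<lambda>p. f p * (moll d i (t - fst p) * moll d j (x - snd p)))"
proof -
  obtain B where B: "\<And>a b. \<bar>moll d i a * moll d j b\<bar> \<le> B"
    using moll_prod_bound[OF d] by metis
  show ?thesis
  proof (rule Bochner_Integration.integrable_bound[where f="\<lambda>p. B * f p"])
    show "integrable lborel (\<lambda>p. B * f p)"
      using f by simp
    show "(\<lambda>p. f p * (moll d i (t - fst p) * moll d j (x - snd p))) \<in> borel_measurable lborel"
      by (rule borel_measurable_times[OF borel_measurable_integrable[OF f]])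
         (use borel_measurable_moll_prod[of d i t j x] in simp)
    have "\<bar>moll d i (t - fst p) * moll d j (x - snd p)\<bar> \<le> \<bar>B\<bar>" for p
      using B abs_ge_self order_trans by blast
    then have "\<bar>f p * (moll d i (t - fst p) * moll d j (x - snd p))\<bar> \<le> \<bar>B * f p\<bar>" for p
      unfolding abs_mult[of "f p"] abs_mult[of B] mult.commute[of "\<bar>B\<bar>"]
      by (intro mult_left_mono) auto
    then show "AE p in lborel. norm (f p * (moll d i (t - fst p) * moll d j (x - snd p))) \<le> norm (B * f p)"
      by simp
  qed
qed

lemma mollify_bound:
  assumes d: "0 < d" and f: "integrable lborel f"
  obtains C where "0 < C"
    "\<And>i j t x. \<bar>mollify d f i j t x\<bar> \<le> C * ((9 / d) ^ i * (fact i)\<^sup>2) * ((9 / d) ^ j * (fact j)\<^sup>2)"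
proof -
  obtain C where C: "0 < C"
    "\<And>i j a b. \<bar>moll d i a * moll d j b\<bar> \<le> C * ((9 / d) ^ i * (fact i)\<^sup>2) * ((9 / d) ^ j * (fact j)\<^sup>2)"
    using moll_prod_bound[OF d] by blast
  let ?N = "\<integral>p. \<bar>f p\<bar> \<partial>lborel"
  have N: "0 \<le> ?N" by simp
  \<comment> \<open>The added 1 keeps the constant positive even if \<open>f\<close> vanishes almost
    everywhere.\<close>
  have "\<bar>mollify d f i j t x\<bar> \<le> (C * (?N + 1)) * ((9 / d) ^ i * (fact i)\<^sup>2) * ((9 / d) ^ j * (fact j)\<^sup>2)" for i j t x
  proof -
    define B where "B = C * ((9 / d) ^ i * (fact i)\<^sup>2) * ((9 / d) ^ j * (fact j)\<^sup>2)"
    have "\<bar>mollify d f i j t x\<bar> \<le> (\<integral>p. \<bar>f p * (moll d i (t - fst p) * moll d j (x - snd p))\<bar> \<partial>lborel)"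
      unfolding mollify_def by (rule integral_abs_bound)
    also have "\<dots> \<le> (\<integral>p. B * \<bar>f p\<bar> \<partial>lborel)"
    proof (rule integral_mono)
      show "integrable lborel (\<lambda>p. \<bar>f p * (moll d i (t - fst p) * moll d j (x - snd p))\<bar>)"
        using integrable_mollify[OF d f] by (rule integrable_abs)
      show "integrable lborel (\<lambda>p. B * \<bar>f p\<bar>)"
        using f by auto
      show "\<bar>f p * (moll d i (t - fst p) * moll d j (x - snd p))\<bar> \<le> B * \<bar>f p\<bar>" for p
        unfolding abs_mult[of "f p"] mult.commute[of B] using C(2)
        by (intro mult_left_mono) (simp_all add: B_def)
    qed
    also have "\<dots> = B * ?N" by simp
    also have "\<dots> \<le> B * (?N + 1)"
      using C d by (intro mult_left_mono) (auto simp: B_def)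
    finally show ?thesis by (simp add: B_def mult_ac)
  qed
  moreover have "0 < C * (?N + 1)" using C(1) N by (intro mult_pos_pos) linarith+
  ultimately show thesis using that by blast
qed

text \<open>The mean value inequality is used twice, first for \<open>g'\<close> and then for
  \<open>g\<close> minus its tangent line; this loses the factor 1/2 of Taylor's formula, which is
  harmless.\<close>

lemma quadratic_remainder_bound:
  fixes g g' g'' :: "real \<Rightarrow> real"
  assumes "\<And>t. (g has_real_derivative g' t) (at t)" "\<And>t. (g' has_real_derivative g'' t) (at t)"
    and "\<And>t. \<bar>g'' t\<bar> \<le> B"
  shows "\<bar>g s - g t - (s - t) * g' t\<bar> \<le> B * (s - t)\<^sup>2"
proof -
  have B: "0 \<le> B" using assms(3)[of 0] by linarith
  have g': "\<bar>g' a - g' b\<bar> \<le> B * \<bar>a - b\<bar>" for a b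
    using field_differentiable_bound[of UNIV g' g'' B a b] assms by auto
  define h where "h = (\<lambda>z. g z - (z - t) * g' t)"
  have h: "(h has_real_derivative (g' z - g' t)) (at z)" for z
    unfolding h_def by (auto intro!: derivative_eq_intros assms)
  have "norm (h s - h t) \<le> (B * \<bar>s - t\<bar>) * norm (s - t)"
  proof (rule field_differentiable_bound[of "closed_segment t s"])
    show "(h has_field_derivative (g' z - g' t)) (at z within closed_segment t s)" for z
      by (rule has_field_derivative_at_within[OF h])
    show "norm (g' z - g' t) \<le> B * \<bar>s - t\<bar>" if "z \<in> closed_segment t s" for z
    proof -
      have "\<bar>z - t\<bar> \<le> \<bar>s - t\<bar>"
        using that by (auto simp: closed_segment_eq_real_ivl split: if_splits)
      then show ?thesis
        using g'[of z t] B by (smt (verit) mult_left_mono real_norm_def)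
    qed
  qed auto
  then show ?thesis
    by (simp add: h_def power2_eq_square abs_mult mult.assoc algebra_simps)
qed

text \<open>A bound on the second derivative of the kernel, uniform in the integration variable,
  makes the first-order remainder quadratic under the integral. This replaces a dominated
  convergence argument for difference quotients.\<close>

lemma has_real_derivative_integral_kernel:
  fixes f :: "'a \<Rightarrow> real" and g :: "nat \<Rightarrow> real \<Rightarrow> 'a \<Rightarrow> real"
  assumes f: "integrable M f"
    and int: "\<And>k t. integrable M (\<lambda>p. f p * g k t p)"
    and der: "\<And>k t p. ((\<lambda>t. g k t p) has_real_derivative g (Suc k) t p) (at t)"
    and bound: "\<And>t p. \<bar>g (k + 2) t p\<bar> \<le> B"
  shows "((\<lambda>t. \<integral>p. f p * g k t p \<partial>M) has_real_derivative (\<integral>p. f p * g (Suc k) t p \<partial>M)) (at t)"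
proof -
  define F where "F = (\<lambda>k t. \<integral>p. f p * g k t p \<partial>M)"
  define R where "R = (\<lambda>s. F k s - F k t - (s - t) * F (Suc k) t)"
  have "(R has_real_derivative 0) (at t)"
  proof (rule has_real_derivative_0I)
    show "R t = 0" by (simp add: R_def)
    fix s
    have "R s = (\<integral>p. f p * (g k s p - g k t p - (s - t) * g (Suc k) t p) \<partial>M)"
      using int[of k s] int[of k t] int[of "Suc k" t]
      by (simp add: R_def F_def right_diff_distrib mult.left_commute[of _ "s - t"])
    also have "\<bar>\<dots>\<bar> \<le> (\<integral>p. \<bar>f p * (g k s p - g k t p - (s - t) * g (Suc k) t p)\<bar> \<partial>M)"
      by (rule integral_abs_bound)
    also have "\<dots> \<le> (\<integral>p. (B * (s - t)\<^sup>2) * \<bar>f p\<bar> \<partial>M)"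
    proof (rule integral_mono)
      have "integrable M (\<lambda>p. f p * (g k s p - g k t p - (s - t) * g (Suc k) t p))"
        using int[of k s] int[of k t] int[of "Suc k" t]
        by (simp add: right_diff_distrib mult.left_commute[of _ "s - t"])
      then show "integrable M (\<lambda>p. \<bar>f p * (g k s p - g k t p - (s - t) * g (Suc k) t p)\<bar>)"
        by (rule integrable_abs)
      show "integrable M (\<lambda>p. (B * (s - t)\<^sup>2) * \<bar>f p\<bar>)"
        using f by auto
      fix p
      have "\<bar>g k s p - g k t p - (s - t) * g (Suc k) t p\<bar> \<le> B * (s - t)\<^sup>2"
        by (rule quadratic_remainder_bound[where g''="\<lambda>t. g (k + 2) t p"])
           (use der[of k] der[of "Suc k"] bound in auto)
      then show "\<bar>f p * (g k s p - g k t p - (s - t) * g (Suc k) t p)\<bar> \<le> (B * (s - t)\<^sup>2) * \<bar>f p\<bar>"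
        unfolding abs_mult[of "f p"] mult.commute[of "B * _"] by (intro mult_left_mono) auto
    qed
    also have "\<dots> = (B * (\<integral>p. \<bar>f p\<bar> \<partial>M)) * (s - t)\<^sup>2"
      by simp
    finally show "\<bar>R s\<bar> \<le> (B * (\<integral>p. \<bar>f p\<bar> \<partial>M)) * (s - t)\<^sup>2" .
  qed
  then have "((\<lambda>s. R s + F k t + (s - t) * F (Suc k) t) has_real_derivative F (Suc k) t) (at t)"
    by (auto intro!: derivative_eq_intros)
  then show ?thesis
    by (simp add: R_def F_def)
qed

lemma moll_shift_deriv:
  assumes "0 < d"
  shows "((\<lambda>t. moll d k (t - a)) has_real_derivative moll d (Suc k) (t - a)) (at t)"
  by (rule DERIV_cong[OF DERIV_chain2[where g="\<lambda>t. t - a" and Db=1, OF moll_deriv[OF assms]]])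
     (auto intro!: derivative_eq_intros)

lemma moll_reflect_deriv:
  assumes "0 < d"
  shows "((\<lambda>t. moll d k (a - t)) has_real_derivative - moll d (Suc k) (a - t)) (at t)"
  by (rule DERIV_cong[OF DERIV_chain2[where g="\<lambda>t. a - t" and Db="-1", OF moll_deriv[OF assms]]])
     (auto intro!: derivative_eq_intros)

lemma mollify_deriv_t:
  assumes d: "0 < d" and f: "integrable lborel f"
  shows "((\<lambda>t. mollify d f i j t x) has_real_derivative mollify d f (Suc i) j t x) (at t)"
proof -
  obtain B where "\<And>a b. \<bar>moll d (i + 2) a * moll d j b\<bar> \<le> B"
    using moll_prod_bound[OF d] by metis
  then show ?thesis
    unfolding mollify_def
    by (intro has_real_derivative_integral_kernel[where g="\<lambda>i t p. moll d i (t - fst p) * moll d j (x - snd p)"]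
         f integrable_mollify d DERIV_cmult_right moll_shift_deriv) auto
qed

lemma mollify_deriv_x:
  assumes d: "0 < d" and f: "integrable lborel f"
  shows "((\<lambda>x. mollify d f i j t x) has_real_derivative mollify d f i (Suc j) t x) (at x)"
proof -
  obtain B where "\<And>a b. \<bar>moll d i a * moll d (j + 2) b\<bar> \<le> B"
    using moll_prod_bound[OF d] by metis
  then show ?thesis
    unfolding mollify_def
    by (intro has_real_derivative_integral_kernel[where g="\<lambda>j x p. moll d i (t - fst p) * moll d j (x - snd p)"]
         f integrable_mollify d DERIV_cmult moll_shift_deriv) auto
qed

text \<open>The kernel centred at (t, x), read as a function of the integration variable: each
  derivative there flips a sign. Starting from orders \<open>i\<close> and \<open>j\<close> lets one
  application of the weak equation reach every derivative of the mollification.\<close>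

lemma test_fun_moll:
  assumes d: "0 < d" and "{t - d..t + d} \<times> {x - d..x + d} \<subseteq> \<Omega>"
  shows "test_fun \<Omega> (\<lambda>a b p. (-1) ^ (a + b) * (moll d (i + a) (t - fst p) * moll d (j + b) (x - snd p)))"
    (is "test_fun \<Omega> ?D")
proof -
  have "smooth_family ?D"
    unfolding smooth_family_def
  proof (intro allI conjI)
    fix a b s y
    show "continuous_on UNIV (?D a b)"
      using d by (intro continuous_intros)
    show "((\<lambda>s. ?D a b (s, y)) has_real_derivative ?D (Suc a) b (s, y)) (at s)"
      using moll_reflect_deriv[OF d, of "i + a" t s]
      by (auto intro!: derivative_eq_intros)
    show "((\<lambda>y. ?D a b (s, y)) has_real_derivative ?D a (Suc b) (s, y)) (at y)"
      using moll_reflect_deriv[OF d, of "j + b" x y]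
      by (auto intro!: derivative_eq_intros)
  qed
  moreover have "{p. ?D 0 0 p \<noteq> 0} \<subseteq> {t - d..t + d} \<times> {x - d..x + d}"
  proof
    fix p assume "p \<in> {p. ?D 0 0 p \<noteq> 0}"
    then have "\<not> d \<le> \<bar>t - fst p\<bar>" "\<not> d \<le> \<bar>x - snd p\<bar>"
      using moll_eq_0[OF d] by auto
    then show "p \<in> {t - d..t + d} \<times> {x - d..x + d}"
      by (cases p) auto
  qed
  moreover have "compact ({t - d..t + d} \<times> {x - d..x + d})"
    by (intro compact_Times compact_Icc)
  ultimately show ?thesis
    unfolding test_fun_def using assms(2)
    by (metis (no_types, lifting) closure_minimal compact_closure bounded_subset compact_imp_bounded
        compact_imp_closed order_trans)
qed

text \<open>The weak equation tested with the kernel. The four terms of the adjoint have odd order,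
  so the signs (-1)^(a+b) turn the adjoint back into P acting in (t, x).\<close>

lemma mollify_kawahara:
  assumes d: "0 < d" and f: "integrable lborel f"
    and sol: "kawahara_sol \<Omega> u"
    and fu: "AE p in lebesgue. indicator \<Omega> p * u p = f p"
    and sub: "{t - d..t + d} \<times> {x - d..x + d} \<subseteq> \<Omega>"
    and \<Omega>: "\<Omega> \<in> sets lebesgue" "u \<in> borel_measurable (lebesgue_on \<Omega>)"
  shows "mollify d f i (j + 5) t x = mollify d f (Suc i) j t x + mollify d f i (j + 1) t x + mollify d f i (j + 3) t x"
proof -
  define D where "D = (\<lambda>a b p. (-1) ^ (a + b) * (moll d (i + a) (t - fst p) * moll d (j + b) (x - snd p)))"
  define E where "E = (\<lambda>p. - D 1 0 p - D 0 1 p - D 0 3 p + D 0 5 p)"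
  have D: "test_fun \<Omega> D"
    unfolding D_def by (rule test_fun_moll[OF d sub])
  have [measurable]: "E \<in> borel_measurable borel"
    unfolding E_def D_def
    by (intro borel_measurable_add borel_measurable_diff borel_measurable_uminus borel_measurable_times
        borel_measurable_const borel_measurable_moll_prod)
  have [measurable]: "f \<in> borel_measurable borel"
    using f by auto
  have m: "(\<lambda>p. indicator \<Omega> p *\<^sub>R u p) \<in> borel_measurable lebesgue"
    using \<Omega> by (subst borel_measurable_restrict_space_iff[symmetric]) auto
  have "0 = set_lebesgue_integral lebesgue \<Omega> (\<lambda>p. u p * E p)"
    using sol D unfolding kawahara_sol_def E_def by simp
  \<comment> \<open>\<open>u\<close> is only Lebesgue measurable and arbitrary off
    \<open>\<Omega>\<close>. Passing to the Borel function \<open>f\<close> makes it possible to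
    drop the completion next.\<close>
  also have "\<dots> = (\<integral>p. f p * E p \<partial>lebesgue)"
    unfolding set_lebesgue_integral_def
  proof (rule integral_cong_AE)
    have "(\<lambda>p. (indicator \<Omega> p *\<^sub>R u p) * E p) \<in> borel_measurable lebesgue"
      by (intro borel_measurable_times m measurable_completion) simp
    then show "(\<lambda>p. indicator \<Omega> p *\<^sub>R (u p * E p)) \<in> borel_measurable lebesgue"
      by (simp add: mult.assoc)
    show "(\<lambda>p. f p * E p) \<in> borel_measurable lebesgue"
      by (intro measurable_completion) simp
    show "AE p in lebesgue. indicator \<Omega> p *\<^sub>R (u p * E p) = f p * E p"
      using fu by eventually_elim (simp flip: mult.assoc)
  qed
  also have "\<dots> = (\<integral>p. f p * E p \<partial>lborel)"
    by (intro integral_completion) simp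
  also have "\<dots> = (\<integral>p. f p * (moll d (Suc i) (t - fst p) * moll d j (x - snd p))
       + f p * (moll d i (t - fst p) * moll d (j + 1) (x - snd p))
       + f p * (moll d i (t - fst p) * moll d (j + 3) (x - snd p))
       - f p * (moll d i (t - fst p) * moll d (j + 5) (x - snd p)) \<partial>lborel)"
    by (simp add: E_def D_def algebra_simps)
  also have "\<dots> = mollify d f (Suc i) j t x + mollify d f i (j + 1) t x + mollify d f i (j + 3) t x - mollify d f i (j + 5) t x"
    unfolding mollify_def using integrable_mollify[OF d f] by simp
  finally show ?thesis by simp
qed

section \<open>Exponential generating functions\<close>

text \<open>Coefficients are stored as derivatives at 0, without the factorial, so that
  differentiating in x is a shift of the sequence and a linear differential equation becomes a
  recurrence.\<close>

definition egf :: "(nat \<Rightarrow> real) \<Rightarrow> real \<Rightarrow> real" where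
  "egf c x = (\<Sum>m. c m / fact m * x ^ m)"

definition egf_conv :: "(nat \<Rightarrow> real) \<Rightarrow> bool" where
  "egf_conv c \<longleftrightarrow> (\<forall>x. summable (\<lambda>m. c m / fact m * x ^ m))"

lemma diffs_egf: "diffs (\<lambda>m. c m / fact m) = (\<lambda>m. c (Suc m) / fact m :: real)"
  by (rule ext) (simp add: diffs_def field_simps del: of_nat_Suc)

lemma egf_conv_Suc: "egf_conv c \<Longrightarrow> egf_conv (\<lambda>m. c (Suc m))"
  unfolding egf_conv_def
  using termdiff_converges_all[of "\<lambda>m. c m / fact m :: real"] by (simp add: diffs_egf)

lemma egf_conv_shift: "egf_conv c \<Longrightarrow> egf_conv (\<lambda>m. c (m + k))"
proof (induction k)
  case (Suc k)
  then show ?case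
    using egf_conv_Suc[of "\<lambda>m. c (m + k)"] by simp
qed simp

lemma egf_conv_add: "egf_conv c \<Longrightarrow> egf_conv c' \<Longrightarrow> egf_conv (\<lambda>m. c m + c' m)"
  unfolding egf_conv_def add_divide_distrib distrib_right by (intro allI summable_add) blast+

lemma egf_conv_dominated:
  assumes "egf_conv M" "\<And>m. \<bar>c m\<bar> \<le> M m"
  shows "egf_conv c"
  unfolding egf_conv_def
proof
  fix x
  show "summable (\<lambda>m. c m / fact m * x ^ m)"
  proof (rule summable_comparison_test')
    show "summable (\<lambda>m. M m / fact m * \<bar>x\<bar> ^ m)"
      using assms(1) unfolding egf_conv_def by blast
    show "norm (c m / fact m * x ^ m) \<le> M m / fact m * \<bar>x\<bar> ^ m" if "0 \<le> m" for m
      using assms(2)[of m]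
      by (auto simp: abs_mult power_abs intro!: mult_right_mono divide_right_mono)
  qed
qed

lemma egf_deriv:
  assumes "egf_conv c"
  shows "(egf c has_real_derivative egf (\<lambda>m. c (Suc m)) x) (at x)"
  using termdiffs_strong_converges_everywhere[of "\<lambda>m. c m / fact m :: real" x] assms
  unfolding egf_conv_def egf_def[abs_def] by (simp add: diffs_egf)

lemma egf_diff:
  assumes "egf_conv c" "egf_conv c'"
  shows "egf (\<lambda>m. c m - c' m) x = egf c x - egf c' x"
  using suminf_diff[of "\<lambda>m. c m / fact m * x ^ m" "\<lambda>m. c' m / fact m * x ^ m"] assms
  unfolding egf_conv_def egf_def by (simp add: diff_divide_distrib left_diff_distrib)

text \<open>The Weierstrass test with abstract \<open>f\<close> and \<open>g\<close> covers two
  uses: joint continuity, with the two projections, and differentiation in the parameter, with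
  \<open>g\<close> constant.\<close>

lemma egf_uniform_limit:
  assumes M: "egf_conv M" and a: "\<And>m t. \<bar>a m t\<bar> \<le> M m" and X: "\<And>p. p \<in> S \<Longrightarrow> \<bar>g p\<bar> \<le> X"
  shows "uniform_limit S (\<lambda>n p. \<Sum>m<n. a m (f p) / fact m * g p ^ m)
     (\<lambda>p. egf (\<lambda>m. a m (f p)) (g p)) sequentially"
  unfolding egf_def
proof (rule Weierstrass_m_test)
  show "summable (\<lambda>m. M m / fact m * X ^ m)"
    using M unfolding egf_conv_def by blast
  show "norm (a m (f p) / fact m * g p ^ m) \<le> M m / fact m * X ^ m" if "p \<in> S" for m p
  proof -
    have "0 \<le> M m" using a[of m undefined] by linarith
    then show ?thesis
      unfolding norm_mult norm_power norm_divide using X[OF that]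
      by (intro mult_mono divide_mono power_mono) (auto simp: a)
  qed
qed

text \<open>Convergence is uniform only for bounded x, hence the argument on a slab around each
  point.\<close>

lemma continuous_on_egf:
  fixes a :: "nat \<Rightarrow> real \<Rightarrow> real"
  assumes M: "egf_conv M" and a: "\<And>m t. \<bar>a m t\<bar> \<le> M m" and c: "\<And>m. continuous_on UNIV (a m)"
  shows "continuous_on UNIV (\<lambda>p. egf (\<lambda>m. a m (fst p)) (snd p))"
proof -
  have "isCont (\<lambda>p. egf (\<lambda>m. a m (fst p)) (snd p)) q" for q :: "real \<times> real"
  proof -
    define S where "S = {p :: real \<times> real. \<bar>snd p\<bar> < \<bar>snd q\<bar> + 1}"
    have "open S"
      unfolding S_def by (intro open_Collect_less continuous_intros)
    moreover have "continuous_on S (\<lambda>p. egf (\<lambda>m. a m (fst p)) (snd p))"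
    proof (rule uniform_limit_theorem[OF _ egf_uniform_limit[OF M a, where X="\<bar>snd q\<bar> + 1"]])
      have "continuous_on S (\<lambda>p. a m (fst p))" for m
        by (rule continuous_on_compose2[OF c]) (auto intro!: continuous_intros)
      then show "\<forall>\<^sub>F n in sequentially. continuous_on S (\<lambda>p. \<Sum>m<n. a m (fst p) / fact m * snd p ^ m)"
        by (intro always_eventually allI continuous_intros) auto
    qed (auto simp: S_def)
    ultimately show ?thesis
      by (metis (mono_tags, lifting) S_def continuous_on_eq_continuous_at less_add_one mem_Collect_eq)
  qed
  then show ?thesis
    by (simp add: continuous_on_eq_continuous_at)
qed

lemma egf_deriv_param:
  fixes a b :: "nat \<Rightarrow> real \<Rightarrow> real"
  assumes M: "egf_conv M" and a: "\<And>m t. \<bar>a m t\<bar> \<le> M m"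
    and N: "egf_conv N" and b: "\<And>m t. \<bar>b m t\<bar> \<le> N m"
    and der: "\<And>m t. (a m has_real_derivative b m t) (at t)"
  shows "((\<lambda>t. egf (\<lambda>m. a m t) x) has_real_derivative egf (\<lambda>m. b m t) x) (at t)"
  unfolding egf_def
proof (rule has_field_derivative_series'(2)[where S="UNIV::real set" and ?x0.0=0 and x=t
      and f="\<lambda>m t. a m t / fact m * x ^ m" and f'="\<lambda>m t. b m t / fact m * x ^ m"])
  show "((\<lambda>t. a m t / fact m * x ^ m) has_real_derivative b m t / fact m * x ^ m) (at t within UNIV)" for m t
    using der[of m t] by (auto intro!: derivative_eq_intros)
  show "uniformly_convergent_on UNIV (\<lambda>n t. \<Sum>m<n. b m t / fact m * x ^ m)"
    using egf_uniform_limit[where a=b and f="\<lambda>t. t" and g="\<lambda>_. x" and X="\<bar>x\<bar>", OF N b]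
    unfolding uniformly_convergent_on_def by blast
  show "summable (\<lambda>m. a m 0 / fact m * x ^ m)"
    using egf_conv_dominated[where c="\<lambda>m. a m 0", OF M a] unfolding egf_conv_def by blast
qed auto

text \<open>The Lagrange remainder is evaluated at some y with |y| <= |x| <= r, where the majorant
  holds; it is thus dominated by a term of a convergent series.\<close>

lemma egf_eq_Taylor:
  assumes der: "\<And>m x. (w m has_real_derivative w (Suc m) x) (at x)"
    and M: "egf_conv M" and bound: "\<And>m y. \<bar>y\<bar> \<le> r \<Longrightarrow> \<bar>w m y\<bar> \<le> M m" and x: "\<bar>x\<bar> \<le> r"
  shows "egf (\<lambda>m. w m 0) x = w 0 x"
proof -
  have "(\<lambda>n. w 0 x - (\<Sum>m<n. w m 0 / fact m * x ^ m)) \<longlonglongrightarrow> 0"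
  proof (rule Lim_null_comparison)
    show "(\<lambda>n. M n / fact n * \<bar>x\<bar> ^ n) \<longlonglongrightarrow> 0"
      using M unfolding egf_conv_def by (intro summable_LIMSEQ_zero) blast
    show "\<forall>\<^sub>F n in sequentially. norm (w 0 x - (\<Sum>m<n. w m 0 / fact m * x ^ m)) \<le> M n / fact n * \<bar>x\<bar> ^ n"
    proof (intro always_eventually allI)
      fix n
      obtain y where y: "\<bar>y\<bar> \<le> \<bar>x\<bar>"
        and eq: "w 0 x = (\<Sum>m<n. w m 0 / fact m * x ^ m) + w n y / fact n * x ^ n"
        using Maclaurin_all_le[of w "w 0" x n] der by auto
      have "\<bar>w n y\<bar> \<le> M n" using bound y x by force
      then show "norm (w 0 x - (\<Sum>m<n. w m 0 / fact m * x ^ m)) \<le> M n / fact n * \<bar>x\<bar> ^ n"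
        unfolding eq by (auto simp: abs_mult power_abs intro!: mult_right_mono divide_right_mono)
    qed
  qed
  then have "(\<lambda>n. w 0 x - (w 0 x - (\<Sum>m<n. w m 0 / fact m * x ^ m))) \<longlonglongrightarrow> w 0 x - 0"
    by (intro tendsto_intros)
  then have "(\<lambda>m. w m 0 / fact m * x ^ m) sums w 0 x"
    by (simp add: sums_def)
  then show ?thesis
    unfolding egf_def by (rule sums_unique[symmetric])
qed

section \<open>Factorial estimates and the cost of x-derivatives\<close>

lemma fact_mult_le_fact_add: "fact a * fact b \<le> (fact (a + b) :: real)"
proof -
  have "fact a * fact b dvd (fact (a + b) :: nat)"
    by (rule fact_fact_dvd_fact)
  then have "fact a * fact b \<le> (fact (a + b) :: nat)"
    by (rule dvd_imp_le) simp
  then have "real (fact a * fact b) \<le> real (fact (a + b))"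
    by (simp only: of_nat_le_iff)
  then show ?thesis by simp
qed

text \<open>The factor \<open>((j div 5)!)\<^sup>2\<close> is negligible against \<open>j!\<close>: \<open>(q!)\<^sup>2 (j - 2q)! \<le> j!\<close> for \<open>5q \<le> j\<close>.\<close>

lemma egf_conv_gevrey:
  assumes "1 \<le> A" "0 \<le> C"
  shows "egf_conv (\<lambda>j. C * A ^ j * (fact (j div 5))\<^sup>2)"
  unfolding egf_conv_def
proof
  fix x :: real
  \<comment> \<open>The factor 2 leaves the geometric factor (1/2)^m for summability; adding 1 to
    |x| ensures Y >= 1, so that powers of Y increase.\<close>
  define Y where "Y = 2 * A * (\<bar>x\<bar> + 1)"
  have Y: "1 \<le> Y" "2 * A * \<bar>x\<bar> \<le> Y"
    using mult_mono[of 1 A 1 "\<bar>x\<bar> + 1"] assms by (auto simp: Y_def algebra_simps)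
  have key: "(fact (j div 5))\<^sup>2 / fact j * Y ^ j \<le> exp (Y\<^sup>2)" for j
  proof -
    define q where "q = j div 5"
    define m where "m = j - 2 * q"
    have "5 * q \<le> j"
      by (simp add: q_def)
    \<comment> \<open>The second part needs only 4 q <= j. It gives Y^j <= (Y^2)^m, so what is left
      is a term of the series of exp(Y^2).\<close>
    then have j: "j = q + q + m" "j \<le> 2 * m"
      unfolding m_def by linarith+
    have "(fact q)\<^sup>2 * fact m \<le> (fact (q + q) * fact m :: real)"
      using fact_mult_le_fact_add[of q q] by (simp add: power2_eq_square mult_right_mono)
    also have "\<dots> \<le> fact j"
      using fact_mult_le_fact_add[of "q + q" m] by (simp add: j(1)[symmetric])
    finally have "(fact q)\<^sup>2 / fact j \<le> (1 / fact m :: real)"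
      by (simp add: field_simps)
    then have "(fact q)\<^sup>2 / fact j * Y ^ j \<le> 1 / fact m * Y ^ (2 * m)"
      using Y(1) j(2) by (intro mult_mono power_increasing) auto
    also have "\<dots> = (Y\<^sup>2) ^ m / fact m"
      by (simp add: power_mult)
    also have "\<dots> \<le> exp (Y\<^sup>2)"
      using exp_minus_le_fact[of "Y\<^sup>2" m] Y(1) by (simp add: exp_minus field_simps)
    finally show ?thesis by (simp add: q_def)
  qed
  show "summable (\<lambda>m. C * A ^ m * (fact (m div 5))\<^sup>2 / fact m * x ^ m)"
  proof (rule summable_comparison_test')
    show "summable (\<lambda>m. C * exp (Y\<^sup>2) * (1 / 2) ^ m)"
      by (intro summable_mult summable_geometric) auto
    fix m
    have "norm (C * A ^ m * (fact (m div 5))\<^sup>2 / fact m * x ^ m)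
        = C * ((fact (m div 5))\<^sup>2 / fact m * (2 * A * \<bar>x\<bar>) ^ m) * (1 / 2) ^ m"
      using assms by (simp add: abs_mult power_abs power_mult_distrib power_divide)
    also have "\<dots> \<le> C * ((fact (m div 5))\<^sup>2 / fact m * Y ^ m) * (1 / 2) ^ m"
      using Y assms by (intro mult_right_mono mult_left_mono power_mono) auto
    also have "\<dots> \<le> C * exp (Y\<^sup>2) * (1 / 2) ^ m"
      using assms by (intro mult_right_mono mult_left_mono key) auto
    finally show "norm (C * A ^ m * (fact (m div 5))\<^sup>2 / fact m * x ^ m) \<le> C * exp (Y\<^sup>2) * (1 / 2) ^ m" .
  qed
qed

text \<open>At a fixed point this is pure recurrence, by induction on \<open>j\<close> for all
  \<open>i\<close> at once: lowering \<open>j\<close> by 5 raises \<open>i\<close> by 1, which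
  leaves \<open>i + j div 5\<close> unchanged. The lower-order terms keep \<open>i\<close> and have
  no larger factorial.\<close>

lemma kawahara_gevrey_bound:
  fixes w :: "nat \<Rightarrow> nat \<Rightarrow> real"
  assumes eq: "\<And>i j. w i (j + 5) = w (Suc i) j + w i (j + 1) + w i (j + 3)"
    and A: "2 \<le> A" "R \<le> A" and R: "0 \<le> R" and C: "0 \<le> C"
    and init: "\<And>i j. j < 5 \<Longrightarrow> \<bar>w i j\<bar> \<le> C * R ^ i * (fact i)\<^sup>2"
  shows "\<bar>w i j\<bar> \<le> C * R ^ i * A ^ j * (fact (i + j div 5))\<^sup>2"
proof (induction j arbitrary: i rule: less_induct)
  case (less j)
  show ?case
  proof (cases "j < 5")
    case True
    have "\<bar>w i j\<bar> \<le> C * R ^ i * (fact i)\<^sup>2 * 1"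
      using init[OF True] by simp
    also have "\<dots> \<le> C * R ^ i * (fact i)\<^sup>2 * A ^ j"
      using A R C by (intro mult_left_mono one_le_power) auto
    finally show ?thesis using True by (simp add: mult_ac)
  next
    case False
    then obtain k where j: "j = k + 5"
      by (metis add.commute le_Suc_ex not_less)
    \<comment> \<open>The claimed bound at j = k + 5 is A^5 F. The three terms on the right are at
      most A F, A F and A^3 F, and A >= 2 makes the sum fit.\<close>
    define F where "F = (fact (Suc (i + k div 5)))\<^sup>2 * (C * R ^ i * A ^ k)"
    have F: "0 \<le> F" using A R C by (simp add: F_def)
    have mono: "(fact (i + l div 5))\<^sup>2 \<le> ((fact (Suc (i + k div 5)))\<^sup>2 :: real)" if "l < k + 5" for l
      using that by (intro power_mono fact_mono) auto
    have "\<bar>w (Suc i) k\<bar> \<le> C * R ^ Suc i * A ^ k * (fact (Suc i + k div 5))\<^sup>2"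
      using less.IH[of k "Suc i"] j by simp
    also have "\<dots> = R * F" by (simp add: F_def mult_ac)
    also have "\<dots> \<le> A * F" using A F by (intro mult_right_mono)
    finally have 1: "\<bar>w (Suc i) k\<bar> \<le> A * F" .
    have "\<bar>w i (k + 1)\<bar> \<le> C * R ^ i * A ^ (k + 1) * (fact (i + (k + 1) div 5))\<^sup>2"
      using less.IH[of "k + 1" i] j by simp
    also have "\<dots> \<le> C * R ^ i * A ^ (k + 1) * (fact (Suc (i + k div 5)))\<^sup>2"
      using A R C by (intro mult_left_mono mono) auto
    also have "\<dots> = A * F" by (simp add: F_def mult_ac)
    finally have 2: "\<bar>w i (k + 1)\<bar> \<le> A * F" .
    have "\<bar>w i (k + 3)\<bar> \<le> C * R ^ i * A ^ (k + 3) * (fact (i + (k + 3) div 5))\<^sup>2"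
      using less.IH[of "k + 3" i] j by simp
    also have "\<dots> \<le> C * R ^ i * A ^ (k + 3) * (fact (Suc (i + k div 5)))\<^sup>2"
      using A R C by (intro mult_left_mono mono) auto
    also have "\<dots> = A ^ 3 * F" by (simp add: F_def power_add mult_ac)
    finally have 3: "\<bar>w i (k + 3)\<bar> \<le> A ^ 3 * F" .
    have A2: "4 \<le> A * A" using mult_mono[of 2 A 2 A] A by simp
    have "A * 4 \<le> A * (A * A)" using A2 A by (intro mult_left_mono) auto
    then have a3: "A + A \<le> A ^ 3" using A by (simp add: power3_eq_cube mult.assoc)
    have "A ^ 3 * 4 \<le> A ^ 3 * (A * A)" using A2 A by (intro mult_left_mono) auto
    moreover have "A ^ 3 * (A * A) = A ^ 5" by (simp add: numeral_eq_Suc)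
    moreover have "0 \<le> A ^ 3" using A by simp
    ultimately have "A + A + A ^ 3 \<le> A ^ 5" using a3 by linarith
    then have "(A + A + A ^ 3) * F \<le> A ^ 5 * F" using F by (rule mult_right_mono)
    then have "\<bar>w i j\<bar> \<le> A ^ 5 * F"
      using 1 2 3 eq[of i k] unfolding j distrib_right by linarith
    then show ?thesis
      by (simp add: j F_def power_add mult_ac)
  qed
qed

section \<open>Classical solutions are weak solutions\<close>

lemma integral_deriv_compact_support:
  fixes g g' :: "real \<Rightarrow> real"
  assumes "\<And>t. (g has_real_derivative g' t) (at t)" "continuous_on UNIV g'"
    and "\<And>t. K \<le> \<bar>t\<bar> \<Longrightarrow> g t = 0" "\<And>t. K \<le> \<bar>t\<bar> \<Longrightarrow> g' t = 0" "0 \<le> K"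
  shows "(\<integral>t. g' t \<partial>lborel) = 0"
proof -
  have "(\<lambda>t. g' t * indicator {-K..K} t) = g'"
  proof
    show "g' t * indicator {-K..K} t = g' t" for t
      using assms(4)[of t] by (cases "K \<le> \<bar>t\<bar>") (auto simp: indicator_def)
  qed
  moreover have "(\<integral>t. g' t * indicator {-K..K} t \<partial>lborel) = g K - g (- K)"
    using assms by (intro integral_FTC_Icc_real) (auto simp: continuous_on_eq_continuous_at)
  ultimately show ?thesis
    using assms(3)[of K] assms(3)[of "-K"] assms(5) by simp
qed

lemma integrable_continuous_compact_support:
  fixes h :: "'a::euclidean_space \<Rightarrow> real"
  assumes "continuous_on UNIV h" "compact S" "\<And>p. p \<notin> S \<Longrightarrow> h p = 0"
  shows "integrable lborel h"
proof -
  have "integrable lborel (\<lambda>p. indicator S p *\<^sub>R h p)"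
    using assms by (intro borel_integrable_compact continuous_on_subset[OF assms(1)]) auto
  moreover have "(\<lambda>p. indicator S p *\<^sub>R h p) = h"
    using assms(3) by (auto simp: fun_eq_iff indicator_def)
  ultimately show ?thesis by metis
qed

text \<open>By Fubini, integrating first in the variable of differentiation; the disjunction lets
  one statement serve both variables.\<close>

lemma integral_partial_compact_support:
  fixes g h :: "real \<times> real \<Rightarrow> real"
  assumes cont: "continuous_on UNIV h" and S: "compact S"
    and zero: "\<And>p. p \<notin> S \<Longrightarrow> g p = 0" "\<And>p. p \<notin> S \<Longrightarrow> h p = 0"
    and der: "(\<forall>t x. ((\<lambda>s. g (s, x)) has_real_derivative h (t, x)) (at t))
      \<or> (\<forall>t x. ((\<lambda>y. g (t, y)) has_real_derivative h (t, x)) (at x))"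
  shows "(\<integral>p. h p \<partial>lborel) = 0"
proof -
  have int: "integrable (lborel \<Otimes>\<^sub>M lborel) h"
    using integrable_continuous_compact_support[OF cont S zero(2)] by (simp add: lborel_prod)
  obtain K where K: "\<And>p. p \<in> S \<Longrightarrow> norm p \<le> K"
    using compact_imp_bounded[OF S] by (auto simp: bounded_iff)
  \<comment> \<open>Strictly above the radius \<open>K\<close>, so that points with a coordinate of
    size exactly \<open>L\<close> already lie outside \<open>S\<close>.\<close>
  define L where "L = \<bar>K\<bar> + 1"
  have out: "(t, x) \<notin> S" if "L \<le> \<bar>t\<bar> \<or> L \<le> \<bar>x\<bar>" for t x
    using K[of "(t, x)"] that norm_fst_le[of t x] norm_snd_le[of x t] unfolding L_def by auto
  have L: "0 \<le> L" by (simp add: L_def)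
  from der show ?thesis
  proof
    assume d: "\<forall>t x. ((\<lambda>s. g (s, x)) has_real_derivative h (t, x)) (at t)"
    have "(\<integral>t. h (t, x) \<partial>lborel) = 0" for x
      using d out zero L
      by (intro integral_deriv_compact_support[where g="\<lambda>s. g (s, x)" and K=L])
         (auto intro!: continuous_on_compose2[OF cont] continuous_intros)
    then have "(\<integral>x. \<integral>t. h (t, x) \<partial>lborel \<partial>lborel) = 0"
      by simp
    then show ?thesis
      using lborel_pair.integral_snd[of "\<lambda>t x. h (t, x)"] int by (simp add: lborel_prod)
  next
    assume d: "\<forall>t x. ((\<lambda>y. g (t, y)) has_real_derivative h (t, x)) (at x)"
    have "(\<integral>x. h (t, x) \<partial>lborel) = 0" for t
      using d out zero L
      by (intro integral_deriv_compact_support[where g="\<lambda>y. g (t, y)" and K=L])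
         (auto intro!: continuous_on_compose2[OF cont] continuous_intros)
    then have "(\<integral>t. \<integral>x. h (t, x) \<partial>lborel \<partial>lborel) = 0"
      by simp
    then show ?thesis
      using lborel_pair.integral_fst[of "\<lambda>t x. h (t, x)"] int by (simp add: lborel_prod)
  qed
qed

lemma smooth_familyD:
  assumes "smooth_family D"
  shows "continuous_on UNIV (D i j)"
    and "((\<lambda>s. D i j (s, x)) has_real_derivative D (Suc i) j (t, x)) (at t)"
    and "((\<lambda>y. D i j (t, y)) has_real_derivative D i (Suc j) (t, x)) (at x)"
  using assms by (simp_all add: smooth_family_def)

text \<open>Test functions constrain only the support of \<open>D 0 0\<close>. Its complement is
  open with open slices, so vanishing passes to t-derivatives and then to x-derivatives by
  induction.\<close>

lemma smooth_family_eq_0: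
  assumes "smooth_family D" and p: "p \<notin> closure {p. D 0 0 p \<noteq> 0}"
  shows "D i j p = 0"
proof -
  define U where "U = - closure {p. D 0 0 p \<noteq> 0}"
  have U: "open U" unfolding U_def by (intro open_Compl closed_closure)
  note der = smooth_familyD(2,3)[OF assms(1)]
  have loc: "open {s. (s, x) \<in> U}" "open {y. (t, y) \<in> U}" for t x
  proof -
    have "continuous_on UNIV (\<lambda>s::real. (s, x))" "continuous_on UNIV (\<lambda>y::real. (t, y))"
      by (intro continuous_intros)+
    then show "open {s. (s, x) \<in> U}" "open {y. (t, y) \<in> U}"
      using open_vimage[OF U, of "\<lambda>s. (s, x)"] open_vimage[OF U, of "\<lambda>y. (t, y)"]
      by (simp_all add: vimage_def)
  qed
  have "\<forall>p\<in>U. D i 0 p = 0"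
  proof (induction i)
    case 0
    then show ?case using closure_subset by (force simp: U_def)
  next
    case (Suc i)
    show ?case
    proof (clarify)
      fix t x assume "(t, x) \<in> U"
      then have "((\<lambda>s. 0) has_real_derivative D (Suc i) 0 (t, x)) (at t)"
        using Suc by (intro has_field_derivative_transform_within_open[OF der(1) loc(1)]) auto
      then show "D (Suc i) 0 (t, x) = 0"
        by (rule DERIV_unique[OF _ DERIV_const])
    qed
  qed
  then have "\<forall>p\<in>U. D i j p = 0"
  proof (induction j)
    case (Suc j)
    show ?case
    proof (clarify)
      fix t x assume "(t, x) \<in> U"
      then have "((\<lambda>y. 0) has_real_derivative D i (Suc j) (t, x)) (at x)"
        using Suc by (intro has_field_derivative_transform_within_open[OF der(2) loc(2)]) auto
      then show "D i (Suc j) (t, x) = 0"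
        by (rule DERIV_unique[OF _ DERIV_const])
    qed
  qed
  then show ?thesis using p by (simp add: U_def)
qed

text \<open>\<open>V\<close> carries x-derivatives only; the single time derivative is expressed
  through them by the equation, which is the form in which the extension is obtained.\<close>

lemma kawahara_sol_classical:
  fixes V :: "nat \<Rightarrow> real \<times> real \<Rightarrow> real"
  assumes cont: "\<And>j. continuous_on UNIV (V j)"
    and dx: "\<And>j t x. ((\<lambda>y. V j (t, y)) has_real_derivative V (Suc j) (t, x)) (at x)"
    and dt: "\<And>t x. ((\<lambda>s. V 0 (s, x)) has_real_derivative V 5 (t, x) - V 1 (t, x) - V 3 (t, x)) (at t)"
  shows "kawahara_sol \<Omega> (V 0)"
  unfolding kawahara_sol_def
proof (intro allI impI)
  fix D assume D: "test_fun \<Omega> D"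
  define S where "S = closure {p. D 0 0 p \<noteq> 0}"
  have S: "compact S" "S \<subseteq> \<Omega>" and sm: "smooth_family D"
    using D unfolding test_fun_def S_def by blast+
  have zero: "D i j p = 0" if "p \<notin> S" for i j p
    using that unfolding S_def by (rule smooth_family_eq_0[OF sm])
  note Dc = smooth_familyD(1)[OF sm] and Dt = smooth_familyD(2)[OF sm] and Dx = smooth_familyD(3)[OF sm]
  \<comment> \<open>Lagrange identity: \<open>E + \<partial>\<^sub>t A = \<partial>\<^sub>x B\<close>, and derivatives of compactly supported functions integrate to 0.\<close>
  define E where "E = (\<lambda>p. V 0 p * (- D 1 0 p - D 0 1 p - D 0 3 p + D 0 5 p))"
  define A where "A = (\<lambda>p. V 0 p * D 0 0 p)"
  define A' where "A' = (\<lambda>p. (V 5 p - V 1 p - V 3 p) * D 0 0 p + D 1 0 p * V 0 p)"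
  \<comment> \<open>The alternating sums telescope: differentiating the five-term sum leaves V0 D05
    + V5 D00, and the three-term sum leaves V0 D03 + V3 D00.\<close>
  define B where "B = (\<lambda>p. V 0 p * D 0 4 p - V 1 p * D 0 3 p + V 2 p * D 0 2 p - V 3 p * D 0 1 p + V 4 p * D 0 0 p
     - V 0 p * D 0 0 p - (V 0 p * D 0 2 p - V 1 p * D 0 1 p + V 2 p * D 0 0 p))"
  define B' where "B' = (\<lambda>p. E p + A' p)"
  note num = eval_nat_numeral
  have Ec: "continuous_on UNIV E" "continuous_on UNIV A'" "continuous_on UNIV B'"
    unfolding E_def A'_def B'_def by (intro continuous_intros cont Dc)+
  have A': "(\<integral>p. A' p \<partial>lborel) = 0"
  proof (rule integral_partial_compact_support[where g=A, OF Ec(2) S(1)])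
    have "((\<lambda>s. A (s, x)) has_real_derivative A' (t, x)) (at t)" for t x
      unfolding A_def by (rule DERIV_cong[OF DERIV_mult'[OF dt Dt]]) (simp add: A'_def algebra_simps)
    then show "(\<forall>t x. ((\<lambda>s. A (s, x)) has_real_derivative A' (t, x)) (at t))
      \<or> (\<forall>t x. ((\<lambda>y. A (t, y)) has_real_derivative A' (t, x)) (at x))" by blast
  qed (auto simp: A_def A'_def zero)
  have B': "(\<integral>p. B' p \<partial>lborel) = 0"
  proof (rule integral_partial_compact_support[where g=B, OF Ec(3) S(1)])
    have m: "((\<lambda>y. V i (t, y) * D 0 j (t, y)) has_real_derivative
        V i (t, x) * D 0 (Suc j) (t, x) + V (Suc i) (t, x) * D 0 j (t, x)) (at x)" for i j t x
      by (rule DERIV_mult'[OF dx Dx])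
    have "((\<lambda>y. B (t, y)) has_real_derivative B' (t, x)) (at x)" for t x
      unfolding B_def
      by (rule DERIV_cong, (rule DERIV_diff DERIV_add m)+) (simp add: B'_def A'_def E_def num algebra_simps)
    then show "(\<forall>t x. ((\<lambda>s. B (s, x)) has_real_derivative B' (t, x)) (at t))
      \<or> (\<forall>t x. ((\<lambda>y. B (t, y)) has_real_derivative B' (t, x)) (at x))" by blast
  qed (auto simp: B_def B'_def A'_def E_def zero)
  have "E p = 0" if "p \<notin> S" for p
    using zero[OF that] by (simp add: E_def)
  then have iE: "(\<lambda>p. indicator \<Omega> p *\<^sub>R E p) = E"
    using S(2) by (auto simp: fun_eq_iff indicator_def)
  have "integrable lborel A'"
    by (rule integrable_continuous_compact_support[OF Ec(2) S(1)]) (simp add: A'_def zero)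
  moreover have "integrable lborel B'"
    by (rule integrable_continuous_compact_support[OF Ec(3) S(1)]) (simp add: B'_def A'_def E_def zero)
  ultimately have "(\<integral>p. B' p - A' p \<partial>lborel) = 0"
    using A' B' by simp
  then have "(\<integral>p. E p \<partial>lborel) = 0"
    unfolding B'_def by simp
  then have "(\<integral>p. E p \<partial>lebesgue) = 0"
    using Ec(1) by (subst integral_completion) (auto intro: borel_measurable_continuous_onI)
  then show "set_lebesgue_integral lebesgue \<Omega> (\<lambda>p. V 0 p * (- D 1 0 p - D 0 1 p - D 0 3 p + D 0 5 p)) = 0"
    unfolding set_lebesgue_integral_def using iE unfolding E_def by simp
qed

section \<open>Convergence of the mollification\<close>

definition clip :: "real \<Rightarrow> real \<Rightarrow> real" where
  "clip N y = max (- N) (min N y)"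

lemma clip_bound: "0 \<le> N \<Longrightarrow> \<bar>clip N y\<bar> \<le> N"
  by (auto simp: clip_def)

lemma clip_eq: "\<bar>y\<bar> \<le> N \<Longrightarrow> clip N y = y"
  by (auto simp: clip_def)

lemma abs_diff_clip_le: "0 \<le> N \<Longrightarrow> \<bar>y - clip N y\<bar> \<le> \<bar>y\<bar>"
  by (auto simp: clip_def max_def min_def)

lemma continuous_on_clip [continuous_intros]:
  "continuous_on A f \<Longrightarrow> continuous_on A (\<lambda>x. clip N (f x))"
  unfolding clip_def by (intro continuous_intros)

lemma borel_measurable_clip [measurable]: "clip N \<in> borel_measurable borel"
  unfolding clip_def[abs_def] by measurable

lemma ex_less_of_null_sequence:
  fixes X :: "nat \<Rightarrow> real"
  assumes "X \<longlonglongrightarrow> 0" "0 < e"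
  obtains n where "X n < e"
  using order_tendstoD(2)[OF assms] by (auto simp: eventually_sequentially)

lemma square_diff_le: "((a::real) - c)\<^sup>2 \<le> 2 * (a - b)\<^sup>2 + 2 * (b - c)\<^sup>2"
  using zero_le_power2[of "a - b - (b - c)"] by (simp add: power2_eq_square algebra_simps)

text \<open>Truncate \<open>f\<close> at height \<open>N\<close>, then approximate it almost
  everywhere by clipped continuous functions; on the compact set \<open>Q\<close> the errors are
  dominated by (2N)^2. The indicator stays outside \<open>g\<close>, so \<open>g\<close> is
  continuous on the whole space without any cut-off construction.\<close>

lemma L2_approx_continuous:
  fixes f :: "'a::euclidean_space \<Rightarrow> real"
  assumes f [measurable]: "f \<in> borel_measurable borel" and f2: "integrable lborel (\<lambda>p. (f p)\<^sup>2)"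
    and Q: "compact Q" "\<And>p. p \<notin> Q \<Longrightarrow> f p = 0" and e: "0 < e"
  obtains g N where "continuous_on UNIV g" "\<And>p. \<bar>g p\<bar> \<le> N"
    "(\<integral>p. (f p - indicator Q p * g p)\<^sup>2 \<partial>lborel) < e"
proof -
  have [measurable]: "Q \<in> sets borel"
    using compact_imp_closed[OF Q(1)] by auto
  have "(\<lambda>N. \<integral>p. (f p - clip (real N) (f p))\<^sup>2 \<partial>lborel) \<longlonglongrightarrow> (\<integral>(p::'a). 0 \<partial>lborel)"
  proof (rule integral_dominated_convergence[where w="\<lambda>p. (f p)\<^sup>2"])
    show "AE p in lborel. (\<lambda>N. (f p - clip (real N) (f p))\<^sup>2) \<longlonglongrightarrow> 0"
    proof (intro AE_I2 tendsto_eventually)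
      fix p
      obtain n where n: "\<bar>f p\<bar> \<le> real n" using real_arch_simple by blast
      show "\<forall>\<^sub>F N in sequentially. (f p - clip (real N) (f p))\<^sup>2 = 0"
        using eventually_ge_at_top[of n]
      proof eventually_elim
        case (elim N)
        then show ?case using n by (simp add: clip_eq)
      qed
    qed
    show "AE p in lborel. norm ((f p - clip (real N) (f p))\<^sup>2) \<le> (f p)\<^sup>2" for N
      using power_mono[OF abs_diff_clip_le, of "real N" _ 2] by simp
  qed (simp_all add: f2)
  then obtain n where n: "(\<integral>p. (f p - clip (real n) (f p))\<^sup>2 \<partial>lborel) < e / 4"
    using e by (auto elim: ex_less_of_null_sequence[where e="e / 4"])
  define N where "N = real n"
  have N: "0 \<le> N" by (simp add: N_def)
  \<comment> \<open>The gauge-integral notion of measurability supplies continuous functions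
    converging to \<open>f\<close> off a negligible set.\<close>
  have "f measurable_on UNIV"
    by (rule lebesgue_measurable_imp_measurable_on_real) (auto intro: measurable_completion)
  then obtain Z h where Z: "negligible Z" and h: "\<And>k. continuous_on UNIV (h k :: 'a \<Rightarrow> real)"
    and lim: "\<And>p. p \<notin> Z \<Longrightarrow> (\<lambda>k. h k p) \<longlonglongrightarrow> f p"
    unfolding measurable_on_def by auto
  have [measurable]: "h k \<in> borel_measurable borel" for k
    using h by (rule borel_measurable_continuous_onI)
  have "AE p in lebesgue. p \<notin> Z"
    using Z by (simp add: AE_not_in negligible_iff_null_sets)
  then have lim': "AE p in lebesgue. (\<lambda>k. h k p) \<longlonglongrightarrow> f p"
    by eventually_elim (rule lim)
  have lim'': "AE p in lborel. (\<lambda>k. h k p) \<longlonglongrightarrow> f p"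
    using lim' by (subst (asm) AE_completion_iff) auto
  have dom: "integrable lborel (\<lambda>p. (2 * N)\<^sup>2 * indicator Q p)"
    using emeasure_compact_finite[OF Q(1)]
    by (intro integrable_mult_right integrable_real_indicator) auto
  have clip_dom: "(clip N (f p) - indicator Q p * clip N (h k p))\<^sup>2 \<le> (2 * N)\<^sup>2 * indicator Q p" for k p
  proof -
    have "\<bar>clip N (f p) - clip N (h k p)\<bar> \<le> 2 * N"
      using clip_bound[OF N, of "f p"] clip_bound[OF N, of "h k p"] by linarith
    then have "(clip N (f p) - clip N (h k p))\<^sup>2 \<le> (2 * N)\<^sup>2"
      using power_mono[of "\<bar>clip N (f p) - clip N (h k p)\<bar>" "2 * N" 2] by simp
    then show ?thesis
      using Q(2)[of p] N by (cases "p \<in> Q") (auto simp: clip_eq)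
  qed
  have "(\<lambda>k. \<integral>p. (clip N (f p) - indicator Q p * clip N (h k p))\<^sup>2 \<partial>lborel) \<longlonglongrightarrow> (\<integral>(p::'a). 0 \<partial>lborel)"
  proof (rule integral_dominated_convergence[where w="\<lambda>p. (2 * N)\<^sup>2 * indicator Q p"])
    show "AE p in lborel. (\<lambda>k. (clip N (f p) - indicator Q p * clip N (h k p))\<^sup>2) \<longlonglongrightarrow> 0"
      using lim''
    proof eventually_elim
      case (elim p)
      have "(\<lambda>k. (clip N (f p) - indicator Q p * clip N (h k p))\<^sup>2)
         \<longlonglongrightarrow> (clip N (f p) - indicator Q p * clip N (f p))\<^sup>2"
        unfolding clip_def by (intro tendsto_intros elim)
      moreover have "clip N (f p) - indicator Q p * clip N (f p) = 0"
        using Q(2)[of p] N by (cases "p \<in> Q") (auto simp: clip_eq)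
      ultimately show ?case by simp
    qed
    show "AE p in lborel. norm ((clip N (f p) - indicator Q p * clip N (h k p))\<^sup>2) \<le> (2 * N)\<^sup>2 * indicator Q p" for k
      using clip_dom by simp
  qed (use dom in simp_all)
  then obtain k where k: "(\<integral>p. (clip N (f p) - indicator Q p * clip N (h k p))\<^sup>2 \<partial>lborel) < e / 4"
    using e by (auto elim: ex_less_of_null_sequence[where e="e / 4"])
  show thesis
  proof
    show "continuous_on UNIV (\<lambda>p. clip N (h k p))"
      by (intro continuous_intros h)
    show "\<bar>clip N (h k p)\<bar> \<le> N" for p
      by (rule clip_bound[OF N])
    have i1: "integrable lborel (\<lambda>p. (f p - clip N (f p))\<^sup>2)"
      by (rule Bochner_Integration.integrable_bound[OF f2])
         (use power_mono[OF abs_diff_clip_le[OF N], of _ 2] in simp_all)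
    have i2: "integrable lborel (\<lambda>p. (clip N (f p) - indicator Q p * clip N (h k p))\<^sup>2)"
      by (rule Bochner_Integration.integrable_bound[OF dom]) (use clip_dom in \<open>simp_all add: abs_mult\<close>)
    have "(\<integral>p. (f p - indicator Q p * clip N (h k p))\<^sup>2 \<partial>lborel)
       \<le> (\<integral>p. 2 * (f p - clip N (f p))\<^sup>2 + 2 * (clip N (f p) - indicator Q p * clip N (h k p))\<^sup>2 \<partial>lborel)"
      using i1 i2 by (intro integral_mono_AE' AE_I2 square_diff_le) auto
    also have "\<dots> = 2 * (\<integral>p. (f p - clip N (f p))\<^sup>2 \<partial>lborel) +
        2 * (\<integral>p. (clip N (f p) - indicator Q p * clip N (h k p))\<^sup>2 \<partial>lborel)"
      using i1 i2 by simp
    also have "\<dots> < e"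
      using n k by (simp add: N_def)
    finally show "(\<integral>p. (f p - indicator Q p * clip N (h k p))\<^sup>2 \<partial>lborel) < e" .
  qed
qed

lemma nn_integral_lborel_prod:
  fixes a b :: "real \<Rightarrow> real"
  assumes [measurable]: "a \<in> borel_measurable borel" "b \<in> borel_measurable borel"
    and a: "\<And>t. 0 \<le> a t"
  shows "(\<integral>\<^sup>+p. ennreal (a (fst p) * b (snd p)) \<partial>lborel) = (\<integral>\<^sup>+t. a t \<partial>lborel) * (\<integral>\<^sup>+x. b x \<partial>lborel)"
proof -
  have "(\<integral>\<^sup>+p. ennreal (a (fst p) * b (snd p)) \<partial>lborel)
      = (\<integral>\<^sup>+p. ennreal (a (fst p) * b (snd p)) \<partial>(lborel \<Otimes>\<^sub>M lborel))"
    by (simp add: lborel_prod)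
  also have "\<dots> = (\<integral>\<^sup>+t. \<integral>\<^sup>+x. ennreal (a t * b x) \<partial>lborel \<partial>lborel)"
    by (subst lborel.nn_integral_fst[symmetric]) auto
  also have "\<dots> = (\<integral>\<^sup>+t. ennreal (a t) * (\<integral>\<^sup>+x. b x \<partial>lborel) \<partial>lborel)"
    using a by (simp add: ennreal_mult' nn_integral_cmult)
  also have "\<dots> = (\<integral>\<^sup>+t. a t \<partial>lborel) * (\<integral>\<^sup>+x. b x \<partial>lborel)"
    by (simp add: nn_integral_multc)
  finally show ?thesis .
qed

section \<open>Averaging against the mollifier: Jensen and contraction in L2\<close>

context
  fixes d :: real
  assumes d: "0 < d"
begin

abbreviation moll2 :: "real \<times> real \<Rightarrow> real \<times> real \<Rightarrow> real" where
  "moll2 z p \<equiv> moll d 0 (fst z - fst p) * moll d 0 (snd z - snd p)"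

lemma moll2_nonneg: "0 \<le> moll2 z p"
  using moll_nonneg[OF d] by simp

lemma nn_integral_moll2:
  shows "(\<integral>\<^sup>+p. ennreal (moll2 z p) \<partial>lborel) = 1" and "(\<integral>\<^sup>+z. ennreal (moll2 z p) \<partial>lborel) = 1"
  using nn_integral_lborel_prod[of "\<lambda>s. moll d 0 (fst z - s)" "\<lambda>y. moll d 0 (snd z - y)"]
    nn_integral_lborel_prod[of "\<lambda>s. moll d 0 (s - fst p)" "\<lambda>y. moll d 0 (y - snd p)"]
  by (auto simp: nn_integral_moll[OF d] moll_nonneg[OF d])

lemma borel_measurable_moll2: "moll2 z \<in> borel_measurable borel"
  by (rule borel_measurable_moll_prod)

lemma has_bochner_integral_moll2: "has_bochner_integral lborel (moll2 z) 1"
  by (rule has_bochner_integral_nn_integral)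
     (use borel_measurable_moll2[of z] in \<open>auto simp: moll2_nonneg nn_integral_moll2\<close>)

lemma integrable_mult_moll2:
  "integrable lborel f \<Longrightarrow> integrable lborel (\<lambda>p. f p * moll2 z p)"
  by (rule integrable_mollify[OF d])

text \<open>Jensen's inequality for the probability density \<open>moll2 z\<close>, obtained from
  nonnegativity of the variance.\<close>

lemma mollify_sq_le:
  assumes "integrable lborel f" "integrable lborel (\<lambda>p. (f p)\<^sup>2)"
  shows "(mollify d f 0 0 (fst z) (snd z))\<^sup>2 \<le> (\<integral>p. (f p)\<^sup>2 * moll2 z p \<partial>lborel)"
proof -
  define m where "m = mollify d f 0 0 (fst z) (snd z)"
  have K: "integrable lborel (moll2 z)" "(\<integral>p. moll2 z p \<partial>lborel) = 1"
    using has_bochner_integral_moll2[of z] by (auto simp: has_bochner_integral_iff)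
  have "0 \<le> (\<integral>p. (f p - m)\<^sup>2 * moll2 z p \<partial>lborel)"
    by (intro integral_nonneg_AE AE_I2 mult_nonneg_nonneg[OF _ moll2_nonneg]) simp
  also have "\<dots> = (\<integral>p. (f p)\<^sup>2 * moll2 z p - 2 * m * (f p * moll2 z p) + m\<^sup>2 * moll2 z p \<partial>lborel)"
    by (simp add: power2_eq_square algebra_simps)
  also have "\<dots> = (\<integral>p. (f p)\<^sup>2 * moll2 z p \<partial>lborel) - 2 * m * (\<integral>p. f p * moll2 z p \<partial>lborel) + m\<^sup>2 * (\<integral>p. moll2 z p \<partial>lborel)"
    using integrable_mult_moll2[OF assms(1), of z] integrable_mult_moll2[OF assms(2), of z] K(1)
    by (subst Bochner_Integration.integral_add Bochner_Integration.integral_diff; simp)+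
  also have "\<dots> = (\<integral>p. (f p)\<^sup>2 * moll2 z p \<partial>lborel) - m\<^sup>2"
    using K(2) by (simp add: m_def mollify_def power2_eq_square)
  finally show ?thesis by (simp add: m_def)
qed

lemma borel_measurable_moll2_joint:
  "(\<lambda>(z, p). moll2 z p) \<in> borel_measurable (lborel \<Otimes>\<^sub>M lborel)"
proof -
  have "continuous_on UNIV (\<lambda>q :: (real \<times> real) \<times> (real \<times> real). moll2 (fst q) (snd q))"
    using d by (intro continuous_intros)
  then have "(\<lambda>q :: (real \<times> real) \<times> (real \<times> real). moll2 (fst q) (snd q)) \<in> borel_measurable borel"
    by (rule borel_measurable_continuous_onI)
  then show ?thesis
    by (simp add: lborel_prod case_prod_beta')
qed

lemma borel_measurable_mollify:
  assumes [measurable]: "f \<in> borel_measurable borel"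
  shows "(\<lambda>z. mollify d f 0 0 (fst z) (snd z)) \<in> borel_measurable borel"
proof -
  note [measurable] = borel_measurable_moll2_joint
  have "(\<lambda>q. f (snd q) * (case q of (z, p) \<Rightarrow> moll2 z p)) \<in> borel_measurable (lborel \<Otimes>\<^sub>M lborel)"
    by measurable
  then have "(\<lambda>(z, p). f p * moll2 z p) \<in> borel_measurable (lborel \<Otimes>\<^sub>M lborel)"
    by (simp add: case_prod_beta')
  then have "(\<lambda>z. \<integral>p. f p * moll2 z p \<partial>lborel) \<in> borel_measurable lborel"
    by (rule lborel.borel_measurable_lebesgue_integral)
  then show ?thesis
    by (simp add: mollify_def)
qed

text \<open>Jensen pointwise, then Tonelli: the kernel also has mass 1 in its first
  argument.\<close>

lemma nn_integral_mollify_sq_le: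
  assumes [measurable]: "f \<in> borel_measurable borel"
    and f: "integrable lborel f" "integrable lborel (\<lambda>p. (f p)\<^sup>2)"
  shows "(\<integral>\<^sup>+z. ennreal ((mollify d f 0 0 (fst z) (snd z))\<^sup>2) \<partial>lborel) \<le> (\<integral>\<^sup>+p. ennreal ((f p)\<^sup>2) \<partial>lborel)"
proof -
  note [measurable] = borel_measurable_moll2_joint
  have "(\<lambda>q. ennreal ((f (snd q))\<^sup>2 * (case q of (z, p) \<Rightarrow> moll2 z p))) \<in> borel_measurable (lborel \<Otimes>\<^sub>M lborel)"
    by measurable
  then have m: "case_prod (\<lambda>z p. ennreal ((f p)\<^sup>2 * moll2 z p)) \<in> borel_measurable (lborel \<Otimes>\<^sub>M lborel)"
    by (simp add: case_prod_beta')
  have "ennreal ((mollify d f 0 0 (fst z) (snd z))\<^sup>2) \<le> (\<integral>\<^sup>+p. ennreal ((f p)\<^sup>2 * moll2 z p) \<partial>lborel)" for z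
  proof -
    have "ennreal ((mollify d f 0 0 (fst z) (snd z))\<^sup>2) \<le> ennreal (\<integral>p. (f p)\<^sup>2 * moll2 z p \<partial>lborel)"
      by (intro ennreal_leI mollify_sq_le f)
    also have "\<dots> = (\<integral>\<^sup>+p. ennreal ((f p)\<^sup>2 * moll2 z p) \<partial>lborel)"
      by (intro nn_integral_eq_integral[symmetric] integrable_mult_moll2 f AE_I2 mult_nonneg_nonneg moll2_nonneg) simp
    finally show ?thesis .
  qed
  then have "(\<integral>\<^sup>+z. ennreal ((mollify d f 0 0 (fst z) (snd z))\<^sup>2) \<partial>lborel)
      \<le> (\<integral>\<^sup>+z. \<integral>\<^sup>+p. ennreal ((f p)\<^sup>2 * moll2 z p) \<partial>lborel \<partial>lborel)"
    by (intro nn_integral_mono)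
  also have "\<dots> = (\<integral>\<^sup>+p. \<integral>\<^sup>+z. ennreal ((f p)\<^sup>2 * moll2 z p) \<partial>lborel \<partial>lborel)"
    by (rule lborel_pair.Fubini'[OF m, symmetric])
  also have "\<dots> = (\<integral>\<^sup>+p. ennreal ((f p)\<^sup>2) * (\<integral>\<^sup>+z. ennreal (moll2 z p) \<partial>lborel) \<partial>lborel)"
  proof (intro nn_integral_cong)
    fix p
    have "(\<lambda>z. moll2 z p) \<in> borel_measurable lborel"
      using measurable_compose[OF measurable_Pair2' borel_measurable_moll2_joint, of p] by simp
    then show "(\<integral>\<^sup>+z. ennreal ((f p)\<^sup>2 * moll2 z p) \<partial>lborel) = ennreal ((f p)\<^sup>2) * (\<integral>\<^sup>+z. ennreal (moll2 z p) \<partial>lborel)"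
      by (subst nn_integral_cmult[symmetric]) (auto simp: ennreal_mult')
  qed
  also have "\<dots> = (\<integral>\<^sup>+p. ennreal ((f p)\<^sup>2) \<partial>lborel)"
    by (simp add: nn_integral_moll2)
  finally show ?thesis .
qed

lemma abs_mollify_diff_le:
  assumes f: "integrable lborel f"
    and near: "\<And>p. \<bar>fst z - fst p\<bar> < d \<Longrightarrow> \<bar>snd z - snd p\<bar> < d \<Longrightarrow> \<bar>f p - f z\<bar> \<le> e"
  shows "\<bar>mollify d f 0 0 (fst z) (snd z) - f z\<bar> \<le> e"
proof -
  have K: "integrable lborel (moll2 z)" "(\<integral>p. moll2 z p \<partial>lborel) = 1"
    using has_bochner_integral_moll2[of z] by (auto simp: has_bochner_integral_iff)
  have i: "integrable lborel (\<lambda>p. (f p - f z) * moll2 z p)"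
    unfolding left_diff_distrib using integrable_mult_moll2[OF f, of z] K(1) by auto
  have "mollify d f 0 0 (fst z) (snd z) - f z = (\<integral>p. f p * moll2 z p \<partial>lborel) - f z * (\<integral>p. moll2 z p \<partial>lborel)"
    using K(2) by (simp add: mollify_def)
  also have "\<dots> = (\<integral>p. (f p - f z) * moll2 z p \<partial>lborel)"
    unfolding left_diff_distrib using integrable_mult_moll2[OF f, of z] K(1) by simp
  finally have "\<bar>mollify d f 0 0 (fst z) (snd z) - f z\<bar> \<le> (\<integral>p. \<bar>(f p - f z) * moll2 z p\<bar> \<partial>lborel)"
    by (simp only: integral_abs_bound)
  also have "\<dots> \<le> (\<integral>p. e * moll2 z p \<partial>lborel)"
  proof (rule integral_mono)
    show "\<bar>(f p - f z) * moll2 z p\<bar> \<le> e * moll2 z p" for p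
    proof (cases "\<bar>fst z - fst p\<bar> < d \<and> \<bar>snd z - snd p\<bar> < d")
      case True
      have "\<bar>(f p - f z) * moll2 z p\<bar> = \<bar>f p - f z\<bar> * moll2 z p"
        using moll2_nonneg[of z p] by (simp only: abs_mult[of "f p - f z"] abs_of_nonneg)
      also have "\<dots> \<le> e * moll2 z p"
        using near True moll2_nonneg by (intro mult_right_mono) auto
      finally show ?thesis .
    next
      case False
      then have "moll2 z p = 0"
        using moll_eq_0[OF d, of "fst z - fst p" 0] moll_eq_0[OF d, of "snd z - snd p" 0] by auto
      then show ?thesis by (simp only: mult_zero_right abs_zero order_refl)
    qed
  qed (use i K in \<open>auto\<close>)
  also have "\<dots> = e * (\<integral>p. moll2 z p \<partial>lborel)"
    by (rule integral_mult_right_zero)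
  finally show ?thesis
    using K(2) by simp
qed

end

lemma square_sum3_le: "((a::real) + b + c)\<^sup>2 \<le> 3 * (a\<^sup>2 + b\<^sup>2 + c\<^sup>2)"
proof -
  have "0 \<le> (a - b)\<^sup>2 + (b - c)\<^sup>2 + (a - c)\<^sup>2" by simp
  then show ?thesis by (simp add: power2_eq_square algebra_simps)
qed

text \<open>With \<open>G\<close> the restriction to \<open>Q\<close> of a continuous approximation,
  the error splits into the mollification of \<open>f - G\<close> (contraction), that of
  \<open>G\<close> minus \<open>G\<close> (uniform continuity), and \<open>G - f\<close>. As
  \<open>G\<close> may jump at the boundary of \<open>Q\<close>, the error is measured on a set
  \<open>S\<close> whose points see only \<open>Q\<close> within distance 1.\<close>

lemma mollify_tendsto_L2:
  fixes f :: "real \<times> real \<Rightarrow> real"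
  assumes fm [measurable]: "f \<in> borel_measurable borel"
    and f: "integrable lborel f" "integrable lborel (\<lambda>p. (f p)\<^sup>2)"
    and Q: "compact Q" "\<And>p. p \<notin> Q \<Longrightarrow> f p = 0"
    and S [measurable]: "S \<in> sets borel"
    and SQ: "\<And>z p. z \<in> S \<Longrightarrow> \<bar>fst z - fst p\<bar> < 1 \<Longrightarrow> \<bar>snd z - snd p\<bar> < 1 \<Longrightarrow> p \<in> Q"
    and e: "0 < e"
  obtains \<delta> where "0 < \<delta>"
    "\<And>d. 0 < d \<Longrightarrow> d < \<delta> \<Longrightarrow>
       (\<integral>\<^sup>+z. indicator S z * ennreal ((mollify d f 0 0 (fst z) (snd z) - f z)\<^sup>2) \<partial>lborel) < ennreal e"
proof -
  obtain g N where g: "continuous_on UNIV g" "\<And>p. \<bar>g p\<bar> \<le> N"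
    and fg: "(\<integral>p. (f p - indicator Q p * g p)\<^sup>2 \<partial>lborel) < e / 12"
    using L2_approx_continuous[OF fm f(2) Q, of "e / 12"] e by auto
  define G where "G = (\<lambda>p. indicator Q p * g p)"
  have [measurable]: "Q \<in> sets borel"
    using compact_imp_closed[OF Q(1)] by auto
  have gm [measurable]: "g \<in> borel_measurable borel"
    using g(1) by (rule borel_measurable_continuous_onI)
  have Gm [measurable]: "G \<in> borel_measurable borel"
    unfolding G_def by measurable
  have "integrable lborel (\<lambda>p. indicator Q p *\<^sub>R g p)" "integrable lborel (\<lambda>p. indicator Q p *\<^sub>R (g p)\<^sup>2)"
    by (intro borel_integrable_compact Q(1) continuous_intros continuous_on_subset[OF g(1)]; simp)+
  moreover have "(\<lambda>p. (G p)\<^sup>2) = (\<lambda>p. indicator Q p *\<^sub>R (g p)\<^sup>2)"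
    by (auto simp: G_def fun_eq_iff indicator_def)
  ultimately have Gi: "integrable lborel G" "integrable lborel (\<lambda>p. (G p)\<^sup>2)"
    by (simp_all add: G_def)
  have di: "integrable lborel (\<lambda>p. f p - G p)"
    using f Gi by auto
  have di2: "integrable lborel (\<lambda>p. (f p - G p)\<^sup>2)"
  proof (rule Bochner_Integration.integrable_bound)
    show "integrable lborel (\<lambda>p. 2 * (f p)\<^sup>2 + 2 * (G p)\<^sup>2)"
      using f Gi by auto
    show "AE p in lborel. norm ((f p - G p)\<^sup>2) \<le> norm (2 * (f p)\<^sup>2 + 2 * (G p)\<^sup>2)"
      using square_diff_le[of "f _" "G _" 0] by auto
  qed simp
  have fgn: "(\<integral>\<^sup>+p. ennreal ((f p - G p)\<^sup>2) \<partial>lborel) \<le> ennreal (e / 12)"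
    using fg by (subst nn_integral_eq_integral[OF di2]) (auto simp: G_def intro!: ennreal_leI)
  have Sfin: "emeasure lborel S < \<infinity>"
  proof -
    have "S \<subseteq> Q" using SQ by fastforce
    then have "emeasure lborel S \<le> emeasure lborel Q" by (intro emeasure_mono) auto
    then show ?thesis
      using emeasure_compact_finite[OF Q(1)] by (simp add: order_le_less_trans)
  qed
  define \<mu> where "\<mu> = measure lborel S"
  have \<mu>: "emeasure lborel S = ennreal \<mu>" "0 \<le> \<mu>"
    using Sfin by (auto simp: \<mu>_def emeasure_eq_ennreal_measure)
  \<comment> \<open>Makes the uniform error contribute at most e/12, like the other two parts; three
    parts with the factor 3 from the squared sum give 3e/4. The 1 added to the measure avoids
    division by zero.\<close>
  define \<eta> where "\<eta> = sqrt (e / (12 * (\<mu> + 1)))"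
  have \<eta>: "0 < \<eta>" "\<eta>\<^sup>2 = e / (12 * (\<mu> + 1))"
    using e \<mu>(2) by (auto simp: \<eta>_def)
  have "uniformly_continuous_on Q g"
    using compact_uniformly_continuous[OF continuous_on_subset[OF g(1)] Q(1)] by simp
  then obtain r where r: "0 < r" "\<And>p q. p \<in> Q \<Longrightarrow> q \<in> Q \<Longrightarrow> dist p q < r \<Longrightarrow> dist (g p) (g q) < \<eta>"
    unfolding uniformly_continuous_on_def using \<eta>(1) by metis
  show thesis
  proof
    \<comment> \<open>Two coordinates, each within d < r/2, give distance below r; the bound 1 keeps
      the kernel inside \<open>Q\<close>.\<close>
    show "0 < min 1 (r / 2)" using r by simp
    fix d assume d: "0 < d" "d < min 1 (r / 2)"
    define m where "m = (\<lambda>f z. mollify d f 0 0 (fst z) (snd z))"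
    have mm [measurable]: "m f \<in> borel_measurable borel" "m G \<in> borel_measurable borel"
      "m (\<lambda>p. f p - G p) \<in> borel_measurable borel"
      unfolding m_def by (intro borel_measurable_mollify[OF d(1)]; measurable)+
    have lin: "m (\<lambda>p. f p - G p) z = m f z - m G z" for z
      unfolding m_def mollify_def left_diff_distrib
      using integrable_mult_moll2[OF d(1) f(1), of z] integrable_mult_moll2[OF d(1) Gi(1), of z] by simp
    have b: "\<bar>m G z - G z\<bar> \<le> \<eta>" if z: "z \<in> S" for z
      unfolding m_def
    proof (rule abs_mollify_diff_le[OF d(1) Gi(1)])
      fix p assume p: "\<bar>fst z - fst p\<bar> < d" "\<bar>snd z - snd p\<bar> < d"
      have inQ: "p \<in> Q" "z \<in> Q"
        using SQ[OF z, of p] SQ[OF z, of z] p d by auto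
      have "dist p z \<le> \<bar>fst z - fst p\<bar> + \<bar>snd z - snd p\<bar>"
        using sqrt_sum_squares_le_sum_abs[of "dist (fst p) (fst z)" "dist (snd p) (snd z)"]
        by (simp add: dist_prod_def dist_real_def abs_minus_commute)
      then have "dist p z < r" using p d by simp
      then show "\<bar>G p - G z\<bar> \<le> \<eta>"
        using r(2)[of p z] inQ by (simp add: G_def dist_real_def)
    qed
    have pt: "indicator S z * ennreal ((m f z - f z)\<^sup>2)
        \<le> 3 * (ennreal ((m (\<lambda>p. f p - G p) z)\<^sup>2) + ennreal (\<eta>\<^sup>2) * indicator S z + ennreal ((f z - G z)\<^sup>2))" for z
    proof (cases "z \<in> S")
      case True
      have "(m f z - f z)\<^sup>2 = (m (\<lambda>p. f p - G p) z + (m G z - G z) + (G z - f z))\<^sup>2"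
        by (simp add: lin)
      also have "\<dots> \<le> 3 * ((m (\<lambda>p. f p - G p) z)\<^sup>2 + (m G z - G z)\<^sup>2 + (G z - f z)\<^sup>2)"
        by (rule square_sum3_le)
      also have "\<dots> \<le> 3 * ((m (\<lambda>p. f p - G p) z)\<^sup>2 + \<eta>\<^sup>2 + (f z - G z)\<^sup>2)"
        using power_mono[OF b[OF True], of 2] by (simp add: power2_commute)
      finally have "ennreal ((m f z - f z)\<^sup>2) \<le> ennreal (3 * ((m (\<lambda>p. f p - G p) z)\<^sup>2 + \<eta>\<^sup>2 + (f z - G z)\<^sup>2))"
        by (rule ennreal_leI)
      then show ?thesis
        using True by (simp add: ennreal_mult' ennreal_plus)
    qed simp
    have "(\<integral>\<^sup>+z. indicator S z * ennreal ((m f z - f z)\<^sup>2) \<partial>lborel)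
       \<le> (\<integral>\<^sup>+z. 3 * (ennreal ((m (\<lambda>p. f p - G p) z)\<^sup>2) + ennreal (\<eta>\<^sup>2) * indicator S z + ennreal ((f z - G z)\<^sup>2)) \<partial>lborel)"
      by (intro nn_integral_mono pt)
    also have "\<dots> = 3 * ((\<integral>\<^sup>+z. ennreal ((m (\<lambda>p. f p - G p) z)\<^sup>2) \<partial>lborel) + ennreal (\<eta>\<^sup>2) * emeasure lborel S
        + (\<integral>\<^sup>+z. ennreal ((f z - G z)\<^sup>2) \<partial>lborel))"
      by (simp add: nn_integral_cmult nn_integral_add)
    also have "\<dots> \<le> 3 * (ennreal (e / 12) + ennreal (\<eta>\<^sup>2) * ennreal \<mu> + ennreal (e / 12))"
    proof -
      have "(\<integral>\<^sup>+z. ennreal ((m (\<lambda>p. f p - G p) z)\<^sup>2) \<partial>lborel) \<le> ennreal (e / 12)"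
        unfolding m_def using nn_integral_mollify_sq_le[OF d(1) _ di di2] fgn by (simp add: order_trans)
      then show ?thesis
        unfolding \<mu>(1) by (intro mult_left_mono add_mono fgn order_refl) auto
    qed
    also have "\<dots> = ennreal (3 * (e / 12 + \<eta>\<^sup>2 * \<mu> + e / 12))"
    proof -
      have "ennreal (3 * (a + b * c + a')) = 3 * (ennreal a + ennreal b * ennreal c + ennreal a')"
        if "0 \<le> a" "0 \<le> b" "0 \<le> c" "0 \<le> a'" for a b c a' :: real
        using that by (subst ennreal_mult') (simp_all add: ennreal_mult' ennreal_plus del: distrib_left_numeral)
      from this[of "e / 12" "\<eta>\<^sup>2" \<mu> "e / 12"] show ?thesis
        using e \<mu>(2) by simp
    qed
    also have "\<dots> < ennreal e"
    proof (rule ennreal_lessI[OF e])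
      have "\<eta>\<^sup>2 * \<mu> \<le> \<eta>\<^sup>2 * (\<mu> + 1)" by (intro mult_left_mono) auto
      also have "\<dots> = e / 12" using \<mu>(2) by (simp add: \<eta>(2) field_simps)
      finally show "3 * (e / 12 + \<eta>\<^sup>2 * \<mu> + e / 12) < e" using e by simp
    qed
    finally show "(\<integral>\<^sup>+z. indicator S z * ennreal ((mollify d f 0 0 (fst z) (snd z) - f z)\<^sup>2) \<partial>lborel) < ennreal e"
      by (simp add: m_def)
  qed
qed

section \<open>Entire extension and conclusion\<close>

text \<open>The recurrence at x = 0 alone makes the Taylor series a solution for all x; the
  hypotheses for |x| <= r identify it with \<open>W\<close> there. The last conclusion transports
  the time support.\<close>

lemma kawahara_entire_extension:
  fixes W :: "nat \<Rightarrow> nat \<Rightarrow> real \<Rightarrow> real \<Rightarrow> real"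
  assumes Wt: "\<And>i j t x. ((\<lambda>t. W i j t x) has_real_derivative W (Suc i) j t x) (at t)"
    and Wx: "\<And>i j t x. ((\<lambda>x. W i j t x) has_real_derivative W i (Suc j) t x) (at x)"
    and eq: "\<And>i j t x. \<bar>x\<bar> \<le> r \<Longrightarrow> W i (j + 5) t x = W (Suc i) j t x + W i (j + 1) t x + W i (j + 3) t x"
    and bound: "\<And>i j t x. \<bar>W i j t x\<bar> \<le> C * (R ^ i * (fact i)\<^sup>2) * (R ^ j * (fact j)\<^sup>2)"
    and C: "0 \<le> C" and R: "0 \<le> R" and r: "0 \<le> r"
  obtains V :: "nat \<Rightarrow> real \<times> real \<Rightarrow> real" where
    "\<And>j. continuous_on UNIV (V j)"
    "\<And>j t x. ((\<lambda>y. V j (t, y)) has_real_derivative V (Suc j) (t, x)) (at x)"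
    "\<And>t x. ((\<lambda>s. V 0 (s, x)) has_real_derivative V 5 (t, x) - V 1 (t, x) - V 3 (t, x)) (at t)"
    "\<And>t x. \<bar>x\<bar> \<le> r \<Longrightarrow> V 0 (t, x) = W 0 0 t x"
    "\<And>t x. (\<And>m. W 0 m t 0 = 0) \<Longrightarrow> V 0 (t, x) = 0"
proof -
  \<comment> \<open>Absorbs the x-derivatives of order below 5 that start the recurrence; 1 + R
    instead of R because R may be below 1.\<close>
  define C' where "C' = C * ((1 + R) ^ 4 * (fact 4)\<^sup>2)"
  define A where "A = max 2 R"
  define M where "M = (\<lambda>j. C' * A ^ j * (fact (j div 5))\<^sup>2)"
  have C': "0 \<le> C'" using C R by (simp add: C'_def)
  have A: "2 \<le> A" "R \<le> A" by (auto simp: A_def)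
  have M: "egf_conv M"
    unfolding M_def using A C' by (intro egf_conv_gevrey) auto
  have W: "\<bar>W 0 j t x\<bar> \<le> M j" if x: "\<bar>x\<bar> \<le> r" for j t x
  proof -
    have "\<bar>W 0 j t x\<bar> \<le> C' * R ^ 0 * A ^ j * (fact (0 + j div 5))\<^sup>2"
    proof (rule kawahara_gevrey_bound[where w="\<lambda>i j. W i j t x", OF _ A R C'])
      show "W i (j + 5) t x = W (Suc i) j t x + W i (j + 1) t x + W i (j + 3) t x" for i j
        by (rule eq[OF x])
      fix i j :: nat assume j: "j < 5"
      have "R ^ j \<le> (1 + R) ^ j" using R by (intro power_mono) auto
      also have "\<dots> \<le> (1 + R) ^ 4" using R j by (intro power_increasing) auto
      finally have Rj: "R ^ j \<le> (1 + R) ^ 4" .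
      have "(fact j)\<^sup>2 \<le> ((fact 4)\<^sup>2 :: real)"
        using j by (intro power_mono fact_mono) auto
      then have "R ^ j * (fact j)\<^sup>2 \<le> (1 + R) ^ 4 * (fact 4)\<^sup>2"
        using Rj R by (intro mult_mono) auto
      then have "C * (R ^ i * (fact i)\<^sup>2) * (R ^ j * (fact j)\<^sup>2) \<le> C * (R ^ i * (fact i)\<^sup>2) * ((1 + R) ^ 4 * (fact 4)\<^sup>2)"
        using C R by (intro mult_left_mono) auto
      also have "\<dots> = C' * R ^ i * (fact i)\<^sup>2"
        by (simp only: C'_def mult_ac)
      finally show "\<bar>W i j t x\<bar> \<le> C' * R ^ i * (fact i)\<^sup>2"
        using bound[of i j t x] by linarith
    qed
    then show ?thesis by (simp add: M_def)
  qed
  then have W0: "\<bar>W 0 (m + j) t 0\<bar> \<le> M (m + j)" for m j t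
    using r by simp
  define V where "V = (\<lambda>j p. egf (\<lambda>m. W 0 (m + j) (fst p) 0) (snd p))"
  have conv: "egf_conv (\<lambda>m. W 0 (m + j) t 0)" for j t
    by (rule egf_conv_dominated[OF egf_conv_shift[OF M] W0])
  show thesis
  proof
    show "continuous_on UNIV (V j)" for j
      unfolding V_def
    proof (rule continuous_on_egf[where a="\<lambda>m t. W 0 (m + j) t 0", OF egf_conv_shift[OF M] W0])
      show "continuous_on UNIV (\<lambda>t. W 0 (m + j) t 0)" for m
        by (rule DERIV_continuous_on[OF has_field_derivative_at_within[OF Wt]])
    qed
    show "((\<lambda>y. V j (t, y)) has_real_derivative V (Suc j) (t, x)) (at x)" for j t x
      unfolding V_def using egf_deriv[OF conv, of j t x] by simp
    have W1: "W (Suc 0) m t 0 = W 0 (m + 5) t 0 - W 0 (m + 1) t 0 - W 0 (m + 3) t 0" for m t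
      using eq[of 0 0 m t] r by simp
    show "((\<lambda>s. V 0 (s, x)) has_real_derivative V 5 (t, x) - V 1 (t, x) - V 3 (t, x)) (at t)" for t x
    proof -
      \<comment> \<open>The majorant for the time-differentiated coefficients comes from the
        equation itself, through three shifts of \<open>M\<close>.\<close>
      have N: "egf_conv (\<lambda>m. M (m + 5) + M (m + 1) + M (m + 3))"
        by (intro egf_conv_add egf_conv_shift M)
      have c: "egf_conv (\<lambda>m. W 0 (m + 5) t 0 - W 0 (m + 1) t 0)"
        by (rule egf_conv_dominated[OF egf_conv_add[OF egf_conv_shift[OF M, of 5] egf_conv_shift[OF M, of 1]]])
           (use W0[of _ 5 t] W0[of _ 1 t] in \<open>smt (verit)\<close>)
      have "((\<lambda>t. egf (\<lambda>m. W 0 m t 0) x) has_real_derivative egf (\<lambda>m. W (Suc 0) m t 0) x) (at t)"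
      proof (rule egf_deriv_param[OF M _ N])
        show "\<bar>W 0 m t 0\<bar> \<le> M m" for m t
          using W0[of m 0 t] by simp
        show "\<bar>W (Suc 0) m t 0\<bar> \<le> M (m + 5) + M (m + 1) + M (m + 3)" for m t
          using W0[of m 5 t] W0[of m 1 t] W0[of m 3 t] unfolding W1 by linarith
      qed (rule Wt)
      also have "(\<lambda>m. W (Suc 0) m t 0) = (\<lambda>m. (W 0 (m + 5) t 0 - W 0 (m + 1) t 0) - W 0 (m + 3) t 0)"
        by (simp add: W1 fun_eq_iff)
      also have "egf \<dots> x = V 5 (t, x) - V 1 (t, x) - V 3 (t, x)"
        unfolding egf_diff[OF c conv] egf_diff[OF conv conv] by (simp add: V_def)
      finally show ?thesis by (simp add: V_def)
    qed
    show "V 0 (t, x) = W 0 0 t x" if "\<bar>x\<bar> \<le> r" for t x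
      using egf_eq_Taylor[where w="\<lambda>m. W 0 m t", OF Wx M W that] by (simp add: V_def)
    show "V 0 (t, x) = 0" if "\<And>m. W 0 m t 0 = 0" for t x
      using that by (simp add: V_def egf_def)
  qed
qed

section \<open>Strips, Borel representatives and L2 norms\<close>

lemma open_strip: "open (strip T a)"
  unfolding strip_def by (intro open_Collect_conj open_Collect_less continuous_intros)

lemma strip_measurable: "strip T a \<in> sets borel" "strip T a \<in> sets lebesgue"
  using open_strip[of T a] by auto

lemma strip_subset: "strip T a \<subseteq> {0..T} \<times> {- a..a}"
  by (auto simp: strip_def)

lemma L2_on_strip_continuous:
  assumes v: "continuous_on UNIV v"
  shows "L2_on (strip T a) v"
  unfolding L2_on_def
proof
  show "v \<in> borel_measurable (lebesgue_on (strip T a))"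
    using borel_measurable_continuous_onI[OF v] by (intro measurable_restrict_space1 measurable_completion) simp
  have "integrable lborel (\<lambda>p. indicator ({0..T} \<times> {- a..a}) p *\<^sub>R (v p)\<^sup>2)"
    by (intro borel_integrable_compact compact_Times compact_Icc continuous_intros continuous_on_subset[OF v]) simp
  then have "set_integrable lborel ({0..T} \<times> {- a..a}) (\<lambda>p. (v p)\<^sup>2)"
    by (simp add: set_integrable_def)
  then have "set_integrable lborel (strip T a) (\<lambda>p. (v p)\<^sup>2)"
    by (rule set_integrable_subset) (use strip_subset strip_measurable in auto)
  then show "set_integrable lebesgue (strip T a) (\<lambda>p. (v p)\<^sup>2)"
    unfolding set_integrable_def by (subst integrable_completion) auto
qed

text \<open>The support condition on \<open>u\<close> holds only almost everywhere; \<open>f\<close>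
  vanishes at every point off \<open>B\<close>, so kernel arguments can be made pointwise.\<close>

lemma L2_on_borel_representative:
  assumes "L2_on \<Omega> u" and \<Omega>: "\<Omega> \<in> sets lebesgue"
    and supp: "supp_in \<Omega> u B" and B: "B \<in> sets borel" "B \<subseteq> \<Omega>"
  obtains f where "f \<in> borel_measurable borel" "\<And>p. p \<notin> B \<Longrightarrow> f p = 0"
    "AE p in lebesgue. indicator \<Omega> p * u p = f p" "integrable lborel (\<lambda>p. (f p)\<^sup>2)"
proof -
  have u: "u \<in> borel_measurable (lebesgue_on \<Omega>)" "set_integrable lebesgue \<Omega> (\<lambda>p. (u p)\<^sup>2)"
    using assms(1) by (auto simp: L2_on_def)
  have m: "(\<lambda>p. indicator \<Omega> p *\<^sub>R u p) \<in> borel_measurable lebesgue"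
    using \<Omega> u by (subst borel_measurable_restrict_space_iff[symmetric]) auto
  then obtain g where g: "g \<in> borel_measurable lborel" "AE p in lborel. indicator \<Omega> p *\<^sub>R u p = g p"
    using completion_ex_borel_measurable_real by blast
  have [measurable]: "g \<in> borel_measurable borel" "B \<in> sets borel" using g B by auto
  define f where "f = (\<lambda>p. indicator B p * g p)"
  have fm [measurable]: "f \<in> borel_measurable borel"
    unfolding f_def by measurable
  have "AE p in lebesgue. indicator \<Omega> p *\<^sub>R u p = g p"
    using g(2) by (rule AE_completion)
  moreover have "AE p in lebesgue. p \<in> \<Omega> \<longrightarrow> p \<notin> B \<longrightarrow> u p = 0"
    using supp \<Omega> unfolding supp_in_def by (subst (asm) AE_restrict_space_iff) auto
  ultimately have ae: "AE p in lebesgue. indicator \<Omega> p * u p = f p"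
    by eventually_elim (use B in \<open>auto simp: f_def indicator_def split: if_splits\<close>)
  have "integrable lebesgue (\<lambda>p. (f p)\<^sup>2)"
  proof (rule integrable_cong_AE_imp)
    show "integrable lebesgue (\<lambda>p. indicator \<Omega> p *\<^sub>R (u p)\<^sup>2)"
      using u(2) by (simp add: set_integrable_def)
    show "(\<lambda>p. (f p)\<^sup>2) \<in> borel_measurable lebesgue"
      by (intro measurable_completion) simp
    show "AE p in lebesgue. indicator \<Omega> p *\<^sub>R (u p)\<^sup>2 = (f p)\<^sup>2"
      using ae by eventually_elim (auto simp: indicator_def split: if_splits)
  qed
  then have "integrable lborel (\<lambda>p. (f p)\<^sup>2)"
    by (subst (asm) integrable_completion) auto
  then show thesis
    using that[OF fm _ ae] by (simp add: f_def)
qed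

text \<open>On the compact set, |f| <= 1 + f^2.\<close>

lemma integrable_of_square:
  fixes f :: "'a::euclidean_space \<Rightarrow> real"
  assumes "f \<in> borel_measurable borel" "integrable lborel (\<lambda>p. (f p)\<^sup>2)"
    and Q: "compact Q" "\<And>p. p \<notin> Q \<Longrightarrow> f p = 0"
  shows "integrable lborel f"
proof (rule Bochner_Integration.integrable_bound)
  have "Q \<in> sets borel" using compact_imp_closed[OF Q(1)] by auto
  then have "integrable lborel (\<lambda>p. indicator Q p :: real)"
    using emeasure_compact_finite[OF Q(1)] by (intro integrable_real_indicator) auto
  then show "integrable lborel (\<lambda>p. indicator Q p + (f p)\<^sup>2)"
    using assms(2) by auto
  show "AE p in lborel. norm (f p) \<le> norm (indicator Q p + (f p)\<^sup>2)"
  proof (intro AE_I2)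
    fix p
    have "0 \<le> (\<bar>f p\<bar> - 1 / 2)\<^sup>2" by simp
    then have "\<bar>f p\<bar> \<le> 1 + (f p)\<^sup>2"
      by (simp add: power2_eq_square algebra_simps)
    then show "norm (f p) \<le> norm (indicator Q p + (f p)\<^sup>2)"
      using Q(2)[of p] by (cases "p \<in> Q") auto
  qed
qed (use assms in simp)

text \<open>Carries the estimate for the Borel pair (mollification \<open>w\<close>, representative
  \<open>f\<close>) over to the pair (extension \<open>v\<close>, original \<open>u\<close>) in the
  Lebesgue norm.\<close>

lemma L2_norm_on_less:
  assumes S: "S \<in> sets borel" "S \<subseteq> \<Omega>" and \<Omega>: "\<Omega> \<in> sets lebesgue"
    and u: "u \<in> borel_measurable (lebesgue_on \<Omega>)"
    and f: "f \<in> borel_measurable borel" "AE p in lebesgue. indicator \<Omega> p * u p = f p"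
    and v: "v \<in> borel_measurable borel" and w: "w \<in> borel_measurable borel" "\<And>p. p \<in> S \<Longrightarrow> v p = w p"
    and e: "0 < e" "(\<integral>\<^sup>+p. indicator S p * ennreal ((w p - f p)\<^sup>2) \<partial>lborel) < ennreal (e\<^sup>2)"
  shows "L2_norm_on S (\<lambda>p. v p - u p) < e"
proof -
  note [measurable] = S(1) f(1) v w(1)
  have m: "(\<lambda>p. indicator \<Omega> p *\<^sub>R u p) \<in> borel_measurable lebesgue"
    using \<Omega> u by (subst borel_measurable_restrict_space_iff[symmetric]) auto
  have wf: "(\<lambda>p. indicator S p * (w p - f p)\<^sup>2) \<in> borel_measurable borel"
    by measurable
  have "set_lebesgue_integral lebesgue S (\<lambda>p. (v p - u p)\<^sup>2) = (\<integral>p. indicator S p * (w p - f p)\<^sup>2 \<partial>lebesgue)"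
    unfolding set_lebesgue_integral_def
  proof (rule integral_cong_AE)
    have "(\<lambda>p. indicator S p * (v p - indicator \<Omega> p *\<^sub>R u p)\<^sup>2) \<in> borel_measurable lebesgue"
      using S(1) v by (intro borel_measurable_times borel_measurable_power borel_measurable_diff m
        measurable_completion) auto
    moreover have "(\<lambda>p. indicator S p * (v p - indicator \<Omega> p *\<^sub>R u p)\<^sup>2) = (\<lambda>p. indicator S p *\<^sub>R (v p - u p)\<^sup>2)"
      using S(2) by (auto simp: fun_eq_iff indicator_def)
    ultimately show "(\<lambda>p. indicator S p *\<^sub>R (v p - u p)\<^sup>2) \<in> borel_measurable lebesgue"
      by simp
    show "(\<lambda>p. indicator S p * (w p - f p)\<^sup>2) \<in> borel_measurable lebesgue"
      using wf by (intro measurable_completion) simp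
    show "AE p in lebesgue. indicator S p *\<^sub>R (v p - u p)\<^sup>2 = indicator S p * (w p - f p)\<^sup>2"
      using f(2) by eventually_elim (use S(2) w(2) in \<open>auto simp: indicator_def split: if_splits\<close>)
  qed
  also have "\<dots> = (\<integral>p. indicator S p * (w p - f p)\<^sup>2 \<partial>lborel)"
    using wf by (intro integral_completion) simp
  also have "\<dots> = enn2real (\<integral>\<^sup>+p. ennreal (indicator S p * (w p - f p)\<^sup>2) \<partial>lborel)"
    using wf by (intro integral_eq_nn_integral) auto
  also have "(\<lambda>p. ennreal (indicator S p * (w p - f p)\<^sup>2)) = (\<lambda>p. indicator S p * ennreal ((w p - f p)\<^sup>2))"
    by (auto simp: fun_eq_iff indicator_def)
  also have "enn2real (\<integral>\<^sup>+p. indicator S p * ennreal ((w p - f p)\<^sup>2) \<partial>lborel) < e\<^sup>2"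
    using e(2) by (cases "\<integral>\<^sup>+p. indicator S p * ennreal ((w p - f p)\<^sup>2) \<partial>lborel") (auto simp: ennreal_less_iff)
  finally have "sqrt (set_lebesgue_integral lebesgue S (\<lambda>p. (v p - u p)\<^sup>2)) < sqrt (e\<^sup>2)"
    by (rule real_sqrt_less_mono)
  then show ?thesis
    using e(1) by (simp add: L2_norm_on_def)
qed

theorem theorem1p2:
  fixes n :: nat and t1 t2 T eps :: real and u :: "real \<times> real \<Rightarrow> real"
  assumes "n \<ge> 2"
    and "0 < t1" and "t1 < t2" and "t2 < T"
    and "L2_on (strip T (real n)) u"
    and "kawahara_sol (strip T (real n)) u"
    and "supp_in (strip T (real n)) u ({t1..t2} \<times> {- real n <..< real n})"
    and "0 < eps" and "eps < min t1 (T - t2)"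
  shows "\<exists>v. L2_on (strip T (real n + 1)) v
           \<and> kawahara_sol (strip T (real n + 1)) v
           \<and> supp_in (strip T (real n + 1)) v ({t1 - eps .. t2 + eps} \<times> {- real n - 1 <..< real n + 1})
           \<and> L2_norm_on (strip T (real n - 1)) (\<lambda>p. v p - u p) < eps"
proof -
  define N where "N = real n"
  have N: "2 \<le> N" using assms(1) by (simp add: N_def)
  define B where "B = {t1..t2} \<times> {- N <..< N}"
  have B: "B \<in> sets borel" "B \<subseteq> strip T N"
    using assms(2,4) by (auto simp: B_def strip_def borel_Times)
  obtain f where f: "f \<in> borel_measurable borel" and f0: "\<And>p. p \<notin> B \<Longrightarrow> f p = 0"
    and fu: "AE p in lebesgue. indicator (strip T N) p * u p = f p"
    and f2: "integrable lborel (\<lambda>p. (f p)\<^sup>2)"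
    using L2_on_borel_representative[OF assms(5) strip_measurable(2) assms(7)] B
    unfolding B_def N_def by blast
  have u: "u \<in> borel_measurable (lebesgue_on (strip T N))"
    using assms(5) by (simp add: L2_on_def N_def)
  \<comment> \<open>Large enough to contain the support of \<open>f\<close> and every point within
    distance 1, in each coordinate, of the strip of half-width N - 1.\<close>
  define Q where "Q = {-1..T + 1} \<times> {- N - 1..N + 1}"
  have Q: "compact Q" unfolding Q_def by (intro compact_Times compact_Icc)
  have fQ: "f p = 0" if "p \<notin> Q" for p
    using that assms(2-4) by (intro f0) (auto simp: Q_def B_def)
  have fi: "integrable lborel f"
    by (rule integrable_of_square[OF f f2 Q fQ])
  obtain \<delta> where \<delta>: "0 < \<delta>" and approx: "\<And>d. 0 < d \<Longrightarrow> d < \<delta> \<Longrightarrow>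
       (\<integral>\<^sup>+z. indicator (strip T (N - 1)) z * ennreal ((mollify d f 0 0 (fst z) (snd z) - f z)\<^sup>2) \<partial>lborel) < ennreal (eps\<^sup>2)"
  proof (rule mollify_tendsto_L2[OF f fi f2 Q fQ strip_measurable(1), of T "N - 1" "eps\<^sup>2"])
    show "p \<in> Q" if "z \<in> strip T (N - 1)" "\<bar>fst z - fst p\<bar> < 1" "\<bar>snd z - snd p\<bar> < 1" for z p
      using that by (cases p) (auto simp: strip_def Q_def abs_less_iff)
  qed (use assms(8) in auto)
  \<comment> \<open>Below \<open>\<delta>\<close> for the approximation. With 2 d < eps, a kernel
    centred at a time in [t1 - d, t2 + d] stays inside (0, T); with d < 1, a centre with |x| <= N -
    1 keeps it inside (-N, N).\<close>
  define d where "d = min (\<delta> / 2) (min (eps / 3) (1 / 2))"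
  have d: "0 < d" "d < \<delta>" "2 * d < eps" "d < 1"
    using \<delta> assms(8) by (auto simp: d_def min_def)
  obtain C where C: "0 < C"
    "\<And>i j t x. \<bar>mollify d f i j t x\<bar> \<le> C * ((9 / d) ^ i * (fact i)\<^sup>2) * ((9 / d) ^ j * (fact j)\<^sup>2)"
    using mollify_bound[OF d(1) fi] by blast
  have outside: "mollify d f i j t x = 0" if t: "t \<notin> {t1 - d..t2 + d}" for i j t x
  proof -
    have "f p * (moll d i (t - fst p) * moll d j (x - snd p)) = 0" for p
    proof (cases "p \<in> B")
      case True
      then have "d \<le> \<bar>t - fst p\<bar>" using t by (auto simp: B_def)
      then show ?thesis using moll_eq_0[OF d(1)] by simp
    qed (simp add: f0)
    then show ?thesis unfolding mollify_def by (simp only: integral_zero)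
  qed
  \<comment> \<open>Valid for every real \<open>t\<close>: inside the enlarged time support the
    kernel square lies in the strip, and outside it all terms vanish. The compact time support of
    \<open>u\<close> thus removes any difficulty at t = 0 and t = T.\<close>
  have eq: "mollify d f i (j + 5) t x = mollify d f (Suc i) j t x + mollify d f i (j + 1) t x + mollify d f i (j + 3) t x"
    if x: "\<bar>x\<bar> \<le> N - 1" for i j t x
  proof (cases "t \<in> {t1 - d..t2 + d}")
    case True
    have "{t - d..t + d} \<times> {x - d..x + d} \<subseteq> strip T N"
      using True x d assms(9) by (auto simp: strip_def abs_le_iff)
    then show ?thesis
      using assms(6) by (intro mollify_kawahara[OF d(1) fi _ fu _ strip_measurable(2) u]) (simp_all add: N_def)
  qed (simp add: outside)
  obtain V where Vc: "\<And>j. continuous_on UNIV (V j)"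
    and Vx: "\<And>j t x. ((\<lambda>y. V j (t, y)) has_real_derivative V (Suc j) (t, x)) (at x)"
    and Vt: "\<And>t x. ((\<lambda>s. V 0 (s, x)) has_real_derivative V 5 (t, x) - V 1 (t, x) - V 3 (t, x)) (at t)"
    and V0: "\<And>t x. \<bar>x\<bar> \<le> N - 1 \<Longrightarrow> V 0 (t, x) = mollify d f 0 0 t x"
    and Vz: "\<And>t x. (\<And>m. mollify d f 0 m t 0 = 0) \<Longrightarrow> V 0 (t, x) = 0"
    by (rule kawahara_entire_extension[where W="mollify d f" and r="N - 1",
          OF mollify_deriv_t[OF d(1) fi] mollify_deriv_x[OF d(1) fi] eq C(2)])
       (use C(1) d(1) N in auto)
  show ?thesis
  proof (intro exI conjI)
    show "L2_on (strip T (real n + 1)) (V 0)"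
      by (rule L2_on_strip_continuous[OF Vc])
    show "kawahara_sol (strip T (real n + 1)) (V 0)"
      by (rule kawahara_sol_classical[OF Vc Vx Vt])
    have "V 0 p = 0" if "p \<in> strip T (N + 1)" "p \<notin> {t1 - eps..t2 + eps} \<times> {- N - 1<..<N + 1}" for p
    proof -
      obtain t x where p: "p = (t, x)" by (cases p)
      have "t \<notin> {t1 - eps..t2 + eps}" using that by (auto simp: strip_def p)
      then have "t \<notin> {t1 - d..t2 + d}" using d by auto
      then show ?thesis unfolding p by (intro Vz outside)
    qed
    then show "supp_in (strip T (real n + 1)) (V 0) ({t1 - eps .. t2 + eps} \<times> {- real n - 1 <..< real n + 1})"
      unfolding supp_in_def N_def[symmetric] by (intro AE_I2) auto
    show "L2_norm_on (strip T (real n - 1)) (\<lambda>p. V 0 p - u p) < eps"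
      unfolding N_def[symmetric]
    proof (rule L2_norm_on_less[OF strip_measurable(1) _ strip_measurable(2) u f fu
          borel_measurable_continuous_onI[OF Vc] borel_measurable_mollify[OF d(1) f] _ assms(8) approx[OF d(1,2)]])
      show "strip T (N - 1) \<subseteq> strip T N"
        by (auto simp: strip_def)
      show "V 0 p = mollify d f 0 0 (fst p) (snd p)" if "p \<in> strip T (N - 1)" for p
        using V0[of "snd p" "fst p"] that by (auto simp: strip_def)
    qed
  qed
qed

end
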